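(* Let $n\ge3$. If $n$ is even, then $H_0(C_n(S^1))\cong H_{n-1}(C_n(S^1))\cong\mathbb{Z}$ and $H_k(C_n(S^1))=0$ for $k\notin\{0,n-1\}$. If $n$ is odd, then $H_0(C_n(S^1))\cong H_n(C_n(S^1))\cong\mathbb{Z}$ and $H_k(C_n(S^1))=0$ for $k\notin\{0,n\}$.
   Context: $C_n(S^1)$ is the set of nonempty subsets of the circle $S^1$ with at most $n$ elements, topologized as a quotient of $(S^1)^n$ via $(x_1,\dots,x_n)\mapsto\{x_1,\dots,x_n\}$. $H_k$ denotes integral (singular/simplicial) homology. *)

theory Defs
  imports "HOL-Analysis.Analysis" "HOL-Homology.Homology" "HOL-Algebra.Elementary_Groups"
begin

definition quotient_topology :: "'a topology \<Rightarrow> ('a \<Rightarrow> 'b) \<Rightarrow> 'b topology" where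
  "quotient_topology X f =
     topology (\<lambda>U. U \<subseteq> f ` topspace X \<and> openin X {x \<in> topspace X. f x \<in> U})"

lemma istopology_quotient:
  "istopology (\<lambda>U. U \<subseteq> f ` topspace X \<and> openin X {x \<in> topspace X. f x \<in> U})"
  unfolding istopology_def
proof (rule conjI; intro allI impI)
  fix S T assume a: "S \<subseteq> f ` topspace X \<and> openin X {x \<in> topspace X. f x \<in> S}"
    "T \<subseteq> f ` topspace X \<and> openin X {x \<in> topspace X. f x \<in> T}"
  have e:  "{x \<in> topspace X. f x \<in> S \<inter> T} = {x \<in> topspace X. f x \<in> S} \<inter> {x \<in> topspace X. f x \<in> T}" by auto
  show "S \<inter> T \<subseteq> f ` topspace X \<and> openin X {x \<in> topspace X. f x \<in> S \<inter> T}"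
    unfolding e using a by (auto intro: openin_Int)
next
  fix K assume a: "\<forall>S\<in>K. S \<subseteq> f ` topspace X \<and> openin X {x \<in> topspace X. f x \<in> S}"
  have e: "{x \<in> topspace X. f x \<in> \<Union>K} = (\<Union>S\<in>K. {x \<in> topspace X. f x \<in> S})" by auto
  show "\<Union>K \<subseteq> f ` topspace X \<and> openin X {x \<in> topspace X. f x \<in> \<Union>K}"
    unfolding e using a by (auto intro!: openin_Union)
qed

definition circle :: "complex topology" where
  "circle = subtopology euclidean (sphere 0 1)"

definition finite_subset_space :: "nat \<Rightarrow> complex set topology" where
  "finite_subset_space n =
     quotient_topology (product_topology (\<lambda>i. circle) {..<n}) (\<lambda>x. x ` {..<n})"

end

theory Submission
  imports Defs
begin

text \<open>
  Cutting the circle at \<open>1\<close>, a finite set of at most \<open>n\<close> points is described by a weakly increasing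
  sequence in \<open>[0,1]\<close>, that is, by a point of a simplex. This makes the space a
  \<open>\<Delta>\<close>-complex with two cells in every dimension: \<open>e\<^sub>k\<close> (sets \<open>{t\<^sub>1 < \<dots> < t\<^sub>k}\<close>
  in the open interval, \<open>1 \<le> k \<le> n\<close>) and \<open>f\<^sub>k\<close> (the same together with the base point,
  \<open>0 \<le> k < n\<close>). Taking faces gives \<open>\<partial>f\<^sub>k = f\<^sub>k\<^sub>-\<^sub>1\<close> and
  \<open>\<partial>e\<^sub>k = 2f\<^sub>k\<^sub>-\<^sub>1 - e\<^sub>k\<^sub>-\<^sub>1\<close> for even \<open>k \<ge> 2\<close>,
  and \<open>0\<close> for odd \<open>k\<close>.

  Attach first the cells \<open>f\<^sub>0, \<dots>, f\<^sub>n\<^sub>-\<^sub>1\<close>, whose union \<open>Y\<close> consists of the sets containing the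
  base point, and then \<open>e\<^sub>1, \<dots>, e\<^sub>n\<close>. In both rounds each even cell cancels the odd cell before it,
  so \<open>Y\<close> modulo a point and the whole space modulo \<open>Y\<close> have homology only if the last
  cell is odd, and then only in its dimension. Exactly one of the two last dimensions \<open>n - 1\<close> and
  \<open>n\<close> is odd.
\<close>

section \<open>Infinite cyclic groups and exact sequences\<close>

definition infinite_cyclic_gen :: "('a, 'b) monoid_scheme \<Rightarrow> 'a \<Rightarrow> bool" where
  "infinite_cyclic_gen G z \<longleftrightarrow> z \<in> carrier G \<and> (\<lambda>n::int. z [^]\<^bsub>G\<^esub> n) \<in> iso integer_group G"

lemma iso_factor_right:
  assumes "g \<in> iso H K" "h \<in> iso G K" "f \<in> hom G H"
    and "\<And>x. x \<in> carrier G \<Longrightarrow> g (f x) = h x"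
  shows "f \<in> iso G H"
proof -
  have bg: "bij_betw g (carrier H) (carrier K)" and bh: "bij_betw h (carrier G) (carrier K)"
    using assms(1,2) by (auto simp: iso_def)
  have im: "f x \<in> carrier H" if "x \<in> carrier G" for x
    using assms(3) that by (auto simp: hom_def)
  have "bij_betw (g \<circ> f) (carrier G) (carrier K)"
    using bh assms(4) bij_betw_cong [of "carrier G" "g \<circ> f" h] by simp
  moreover have "f ` carrier G \<subseteq> carrier H" using im by auto
  ultimately have "bij_betw f (carrier G) (carrier H)"
    using bij_betw_comp_iff2 [OF bg] by blast
  then show ?thesis using assms(3) by (simp add: iso_def)
qed

lemma iso_factor_left:
  assumes "f \<in> iso G H" "h \<in> iso G K" "g \<in> hom H K"
    and "\<And>x. x \<in> carrier G \<Longrightarrow> g (f x) = h x"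
  shows "g \<in> iso H K"
proof -
  have bf: "bij_betw f (carrier G) (carrier H)" and bh: "bij_betw h (carrier G) (carrier K)"
    using assms(1,2) by (auto simp: iso_def)
  have "bij_betw (g \<circ> f) (carrier G) (carrier K)"
    using bh assms(4) bij_betw_cong [of "carrier G" "g \<circ> f" h] by simp
  then have "bij_betw g (carrier H) (carrier K)"
    using bf bij_betw_comp_iff by blast
  then show ?thesis using assms(3) by (simp add: iso_def)
qed

lemma infinite_cyclic_gen_iso_iff:
  assumes "h \<in> iso G H" "z \<in> carrier G" "group G" "group H"
  shows "infinite_cyclic_gen H (h z) \<longleftrightarrow> infinite_cyclic_gen G z"
proof -
  have hom: "h \<in> hom G H" using assms(1) by (simp add: iso_def)
  have pow: "h (z [^]\<^bsub>G\<^esub> n) = h z [^]\<^bsub>H\<^esub> n" for n :: int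
    by (rule hom_int_pow [OF hom assms(2-4)])
  have hz: "h z \<in> carrier H" using hom assms(2) by (auto simp: hom_def)
  interpret G: group G by fact
  have pc: "(\<lambda>n::int. z [^]\<^bsub>G\<^esub> n) \<in> hom integer_group G"
    using assms(2) by (auto intro: G.hom_integer_group_pow)
  show ?thesis
  proof
    assume "infinite_cyclic_gen H (h z)"
    then have "(\<lambda>n::int. h z [^]\<^bsub>H\<^esub> n) \<in> iso integer_group H"
      by (simp add: infinite_cyclic_gen_def)
    then have "(\<lambda>n::int. z [^]\<^bsub>G\<^esub> n) \<in> iso integer_group G"
      using iso_factor_right [OF assms(1) _ pc] pow by simp
    then show "infinite_cyclic_gen G z"
      using assms(2) by (simp add: infinite_cyclic_gen_def)
  next
    assume "infinite_cyclic_gen G z"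
    then have "h \<circ> (\<lambda>n::int. z [^]\<^bsub>G\<^esub> n) \<in> iso integer_group H"
      using iso_set_trans [OF _ assms(1)] by (auto simp: infinite_cyclic_gen_def)
    then show "infinite_cyclic_gen H (h z)"
      using hz by (simp add: infinite_cyclic_gen_def o_def pow)
  qed
qed

lemma infinite_cyclic_gen_imp_iso:
  assumes "infinite_cyclic_gen G z" shows "G \<cong> integer_group"
  using assms group.iso_sym [OF group_integer_group] by (auto simp: infinite_cyclic_gen_def is_iso_def)

lemma hom_gen_imp_iso:
  assumes "infinite_cyclic_gen G z" "h \<in> hom G H" "infinite_cyclic_gen H (h z)" "group G" "group H"
  shows "h \<in> iso G H"
  by (rule iso_factor_left [where f = "\<lambda>n::int. z [^]\<^bsub>G\<^esub> n" and h = "\<lambda>n::int. h z [^]\<^bsub>H\<^esub> n"])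
     (use assms in \<open>auto simp: infinite_cyclic_gen_def intro: hom_int_pow\<close>)

lemma infinite_cyclic_gen_inv:
  assumes "infinite_cyclic_gen G z" "comm_group G"
  shows "infinite_cyclic_gen G (inv\<^bsub>G\<^esub> z)"
proof -
  interpret G: comm_group G by fact
  have "(\<lambda>x. inv\<^bsub>G\<^esub> x) \<in> iso G G"
    by (auto simp: iso_def hom_def G.inv_mult bij_betw_def inj_on_def image_iff intro: G.inv_inv [symmetric])
  then show ?thesis
    using infinite_cyclic_gen_iso_iff [of "\<lambda>x. inv\<^bsub>G\<^esub> x" G G z] assms
    by (simp add: infinite_cyclic_gen_def)
qed

lemma hom_trivial_imp_iso:
  assumes "trivial_group G" "trivial_group H" "h \<in> hom G H"
  shows "h \<in> iso G H"
proof -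
  have g: "carrier G = {\<one>\<^bsub>G\<^esub>}" "carrier H = {\<one>\<^bsub>H\<^esub>}"
    using assms by (auto simp: trivial_group_def)
  then show ?thesis using assms(3) by (auto simp: iso_def bij_betw_def hom_def)
qed

lemma exact_seq_middle_trivial:
  assumes ex: "exact_seq ([C,B,A], [g,f])" and "trivial_group A" "trivial_group C"
  shows "trivial_group B"
proof -
  have A: "carrier A = {\<one>\<^bsub>A\<^esub>}" and C: "carrier C = {\<one>\<^bsub>C\<^esub>}"
    using assms(2,3) by (auto simp: trivial_group_def)
  have f: "group_hom A B f" and g: "group_hom B C g" and k: "kernel B C g = f ` carrier A"
    using ex by (auto simp: group_hom_def group_hom_axioms_def)
  have "kernel B C g = carrier B"
    using group_hom.hom_closed [OF g] C by (auto simp: kernel_def)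
  moreover have "f ` carrier A = {\<one>\<^bsub>B\<^esub>}"
    using A group_hom.hom_one [OF f] by auto
  ultimately show ?thesis
    using k f by (auto simp: trivial_group_def group_hom_def)
qed

context
  fixes X :: "'a topology" and S T :: "'a set"
  assumes TS: "T \<subseteq> S"
begin

lemma iso_hom_induced_triple:
  assumes "\<And>k. trivial_group (relative_homology_group k (subtopology X S) T)"
  shows "hom_induced p X T X S id \<in> iso (relative_homology_group p X T) (relative_homology_group p X S)"
proof (rule very_short_exact_sequence)
  show "exact_seq ([relative_homology_group (p-1) (subtopology X S) T, relative_homology_group p X S,
     relative_homology_group p X T, relative_homology_group p (subtopology X S) T],
     [hom_relboundary p X S T, hom_induced p X T X S id, hom_induced p (subtopology X S) T X T id])"
    using homology_exactness_triple_1 [OF TS, of p X] homology_exactness_triple_3 [OF TS, of p X]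
    by simp
qed (rule assms)+

lemma iso_hom_relboundary_triple:
  assumes "\<And>k. trivial_group (relative_homology_group k X T)"
  shows "hom_relboundary p X S T \<in> iso (relative_homology_group p X S) (relative_homology_group (p-1) (subtopology X S) T)"
proof (rule very_short_exact_sequence)
  show "exact_seq ([relative_homology_group (p-1) X T, relative_homology_group (p-1) (subtopology X S) T, 
     relative_homology_group p X S, relative_homology_group p X T],
     [hom_induced (p-1) (subtopology X S) T X T id, hom_relboundary p X S T, hom_induced p X T X S id])"
    using homology_exactness_triple_1 [OF TS, of p X] homology_exactness_triple_2 [OF TS, of p X]
    by simp
qed (rule assms)+

lemma trivial_relative_homology_group_triple:
  assumes "\<And>k. hom_relboundary k X S T \<in> iso (relative_homology_group k X S) (relative_homology_group (k-1) (subtopology X S) T)"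
  shows "trivial_group (relative_homology_group p X T)"
proof (rule exact_seq_imp_triviality)
  show "exact_seq ([relative_homology_group (p-1) (subtopology X S) T, relative_homology_group p X S,
     relative_homology_group p X T, relative_homology_group p (subtopology X S) T, relative_homology_group (p+1) X S],
     [hom_relboundary p X S T, hom_induced p X T X S id, hom_induced p (subtopology X S) T X T id, hom_relboundary (p+1) X S T])"
    using homology_exactness_triple_1 [OF TS, of p X] homology_exactness_triple_3 [OF TS, of p X]
       homology_exactness_triple_2 [OF TS, of "p+1" X] 
    by simp
  show "hom_relboundary (p+1) X S T \<in> iso (relative_homology_group (p+1) X S) (relative_homology_group p (subtopology X S) T)"
    using assms [of "p+1"] by simp
qed (rule assms)

end

lemma iso_hom_induced_acyclic_subspace:
  assumes A: "\<And>k. k \<noteq> 0 \<Longrightarrow> trivial_group (homology_group k (subtopology X A))" 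
    and X1: "trivial_group (relative_homology_group 1 X A)" and "p \<noteq> 0"
  shows "hom_induced p X {} X A id \<in> iso (homology_group p X) (relative_homology_group p X A)"
proof (cases "p = 1")
  case False
  show ?thesis
  proof (rule very_short_exact_sequence)
    show "exact_seq ([homology_group (p-1) (subtopology X A), relative_homology_group p X A, homology_group p X, homology_group p (subtopology X A)],
              [hom_boundary p X A, hom_induced p X {} X A id, hom_induced p (subtopology X A) {} X {} id])"
      using homology_exactness_axiom_1 [of p X A] homology_exactness_axiom_3 [of p X A] by simp
  qed (use A False \<open>p \<noteq> 0\<close> in auto)
next
  case True
  have ex: "exact_seq ([relative_homology_group p X A, homology_group p X, homology_group p (subtopology X A)],
              [hom_induced p X {} X A id, hom_induced p (subtopology X A) {} X {} id])"
    by (rule homology_exactness_axiom_3)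
  have tA: "trivial_group (homology_group p (subtopology X A))" using A \<open>p \<noteq> 0\<close> by blast
  have "trivial_group (homology_group p X)"
    by (rule exact_seq_middle_trivial [OF ex tA]) (use X1 True in simp)
  then show ?thesis
    by (intro hom_trivial_imp_iso hom_induced_hom) (use X1 True in auto)
qed

section \<open>Radial projection in the standard simplex\<close>

abbreviation simplex_space :: "nat \<Rightarrow> (nat \<Rightarrow> real) topology" where
  "simplex_space p \<equiv> subtopology (powertop_real UNIV) (standard_simplex p)"

definition simplex_bd :: "nat \<Rightarrow> (nat \<Rightarrow> real) set" where
  "simplex_bd p = {x \<in> standard_simplex p. \<exists>i\<le>p. x i = 0}"

definition barycenter :: "nat \<Rightarrow> nat \<Rightarrow> real" where
  "barycenter p = (\<lambda>i. if i \<le> p then 1 / real (Suc p) else 0)"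

definition min_coord :: "nat \<Rightarrow> (nat \<Rightarrow> real) \<Rightarrow> real" where
  "min_coord p x = Min (x ` {..p})"

text \<open>At time 1 this is the projection from the barycenter onto the boundary of the simplex.\<close>

definition radial_push :: "nat \<Rightarrow> real \<Rightarrow> (nat \<Rightarrow> real) \<Rightarrow> nat \<Rightarrow> real" where
  "radial_push p t x = (\<lambda>i. if i \<le> p then
     (1 - t) * x i + t * ((x i - min_coord p x) / (1 - real (Suc p) * min_coord p x)) else 0)"

lemma standard_simplexI:
  assumes "\<And>i. i \<le> p \<Longrightarrow> 0 \<le> x i" "\<And>i. i > p \<Longrightarrow> x i = 0" "(\<Sum>i\<le>p. x i) = 1"
  shows "x \<in> standard_simplex p"
proof -
  have "0 \<le> x i" for i using assms(1,2) [of i] by (cases "i \<le> p") auto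
  moreover have "x i \<le> 1" for i
  proof (cases "i \<le> p")
    case True
    then have "x i \<le> (\<Sum>i\<le>p. x i)" by (intro member_le_sum) (use assms(1) in auto)
    then show ?thesis using assms(3) by simp
  qed (use assms(2) in auto)
  ultimately show ?thesis using assms by (auto simp: standard_simplex_def)
qed

lemma barycenter_in_simplex: "barycenter p \<in> standard_simplex p - simplex_bd p"
proof -
  have "barycenter p \<in> standard_simplex p"
    by (rule standard_simplexI) (auto simp: barycenter_def)
  then show ?thesis by (auto simp: simplex_bd_def barycenter_def)
qed

lemma min_coord_le: "i \<le> p \<Longrightarrow> min_coord p x \<le> x i"
  by (simp add: min_coord_def)

lemma min_coord_attained: obtains i where "i \<le> p" "x i = min_coord p x"
proof -
  have "min_coord p x \<in> x ` {..p}" unfolding min_coord_def by (rule Min_in) auto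
  then show ?thesis using that by auto
qed

lemma min_coord_nonneg: "x \<in> standard_simplex p \<Longrightarrow> 0 \<le> min_coord p x"
  by (simp add: min_coord_def standard_simplex_def)

lemma min_coord_less:
  assumes x: "x \<in> standard_simplex p" and "x \<noteq> barycenter p"
  shows "real (Suc p) * min_coord p x < 1"
proof (rule ccontr)
  assume n: "\<not> real (Suc p) * min_coord p x < 1"
  have s: "(\<Sum>i\<le>p. x i) = 1" using x by (simp add: standard_simplex_def)
  have "(\<Sum>i\<le>p. x i - min_coord p x) = 1 - real (Suc p) * min_coord p x"
    by (simp add: sum_subtractf s)
  moreover have "0 \<le> (\<Sum>i\<le>p. x i - min_coord p x)"
    by (intro sum_nonneg) (simp add: min_coord_le)
  ultimately have z: "(\<Sum>i\<le>p. x i - min_coord p x) = 0" and m: "real (Suc p) * min_coord p x = 1"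
    using n by linarith+
  have "x i - min_coord p x = 0" if "i \<le> p" for i
    using z that by (subst (asm) sum_nonneg_eq_0_iff) (auto simp: min_coord_le)
  moreover have "min_coord p x = 1 / real (Suc p)" using m by (simp add: field_simps)
  ultimately have "x = barycenter p"
    using x by (auto simp: barycenter_def standard_simplex_def fun_eq_iff)
  then show False using assms by simp
qed

lemma min_coord_bd: "x \<in> simplex_bd p \<Longrightarrow> min_coord p x = 0"
  using min_coord_le [of _ p x] min_coord_nonneg [of x p] by (fastforce simp: simplex_bd_def)

lemma radial_push_in_simplex:
  assumes x: "x \<in> standard_simplex p" "x \<noteq> barycenter p" and t: "0 \<le> t" "t \<le> 1"
  shows "radial_push p t x \<in> standard_simplex p"
proof (rule standard_simplexI)
  define m where "m = min_coord p x"
  have lt: "1 - real (Suc p) * m > 0" using min_coord_less [OF x] by (simp add: m_def)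
  have s: "(\<Sum>i\<le>p. x i) = 1" using x by (simp add: standard_simplex_def)
  show "0 \<le> radial_push p t x i" if "i \<le> p" for i
  proof -
    have "0 \<le> x i" using x by (simp add: standard_simplex_def)
    then show ?thesis
      using that t lt min_coord_le [OF that, of x]
      by (auto simp: radial_push_def m_def [symmetric] intro!: add_nonneg_nonneg mult_nonneg_nonneg divide_nonneg_nonneg simp del: of_nat_Suc)
  qed
  have "(\<Sum>i\<le>p. radial_push p t x i) = 
       (\<Sum>i\<le>p. (1 - t) * x i + t * ((x i - m) / (1 - real (Suc p) * m)))"
    by (simp add: radial_push_def m_def)
  also have "\<dots> = (1 - t) * (\<Sum>i\<le>p. x i) + t * ((\<Sum>i\<le>p. x i - m) / (1 - real (Suc p) * m))"
    unfolding sum.distrib sum_distrib_left sum_divide_distrib by simp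
  also have "(\<Sum>i\<le>p. x i - m) = 1 - real (Suc p) * m"
    by (simp add: sum_subtractf s)
  finally show "(\<Sum>i\<le>p. radial_push p t x i) = 1" using lt s by simp
qed (simp add: radial_push_def)

lemma radial_push_not_barycenter:
  assumes x: "x \<in> standard_simplex p" "x \<noteq> barycenter p" and t: "0 \<le> t" "t \<le> 1"
  shows "radial_push p t x \<noteq> barycenter p"
proof -
  obtain i where i: "i \<le> p" "x i = min_coord p x" using min_coord_attained .
  have "(1 - t) * x i \<le> x i"
    using t min_coord_nonneg [OF x(1)] i by (simp add: mult_left_le_one_le)
  then have "radial_push p t x i \<le> x i" using i by (simp add: radial_push_def)
  also have "x i < 1 / real (Suc p)"
    using min_coord_less [OF x] i by (simp add: field_simps)
  finally show ?thesis using i by (auto simp: barycenter_def)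
qed

lemma radial_push_0: "x \<in> standard_simplex p \<Longrightarrow> radial_push p 0 x = x"
  by (auto simp: radial_push_def standard_simplex_def)

lemma radial_push_bd: "x \<in> simplex_bd p \<Longrightarrow> radial_push p t x = x"
  by (frule min_coord_bd) (auto simp: radial_push_def simplex_bd_def standard_simplex_def algebra_simps)

lemma radial_push_1:
  assumes x: "x \<in> standard_simplex p" "x \<noteq> barycenter p"
  shows "radial_push p 1 x \<in> simplex_bd p"
proof -
  obtain i where "i \<le> p" "x i = min_coord p x" using min_coord_attained .
  then have "radial_push p 1 x i = 0" by (simp add: radial_push_def)
  then show ?thesis
    using radial_push_in_simplex [OF x] \<open>i \<le> p\<close> by (auto simp: simplex_bd_def)
qed

lemma continuous_map_coord: "continuous_map (powertop_real UNIV) euclideanreal (\<lambda>x. x i)"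
  using continuous_map_product_projection [of i UNIV "\<lambda>_. euclideanreal"] by simp

lemma continuous_map_min_coord:
  assumes "\<And>i. i \<le> p \<Longrightarrow> continuous_map X euclideanreal (\<lambda>z. f z i)"
  shows "continuous_map X euclideanreal (\<lambda>z. min_coord p (f z))"
  using assms
proof (induction p)
  case 0
  then show ?case by (simp add: min_coord_def)
next
  case (Suc p)
  have "min_coord (Suc p) x = min (x (Suc p)) (min_coord p x)" for x
    by (simp add: min_coord_def atMost_Suc)
  then show ?case
    using Suc by (simp add: continuous_map_real_min)
qed

lemma continuous_map_radial_push:
  "continuous_map (prod_topology (top_of_set {0..1}) (subtopology (simplex_space p) (- {barycenter p})))
     (subtopology (simplex_space p) (- {barycenter p})) (\<lambda>(t,x). radial_push p t x)"
proof -
  let ?D = "subtopology (simplex_space p) (- {barycenter p})"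
  let ?P = "prod_topology (top_of_set {0..1::real}) ?D"
  have [simp]: "topspace ?P = {0..1} \<times> (standard_simplex p - {barycenter p})" by auto
  have pr: "continuous_map ?P euclideanreal (\<lambda>z. snd z i)" for i
    by (intro continuous_map_compose [OF continuous_map_snd, unfolded o_def] continuous_map_from_subtopology
        continuous_map_coord)
  have mc: "continuous_map ?P euclideanreal (\<lambda>z. min_coord p (snd z))"
    by (rule continuous_map_min_coord) (rule pr)
  have t: "continuous_map ?P euclideanreal fst"
    using continuous_map_fst continuous_map_into_fulltopology by blast
  have "continuous_map ?P euclideanreal (\<lambda>z. radial_push p (fst z) (snd z) i)" for i
  proof (cases "i \<le> p")
    case True
    have ne: "1 - real (Suc p) * min_coord p (snd z) \<noteq> 0" if "z \<in> topspace ?P" for z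
      using min_coord_less [of "snd z" p] that by auto
    show ?thesis
      unfolding radial_push_def using True
      by (simp del: of_nat_Suc) (intro continuous_map_add continuous_map_real_mult continuous_map_diff continuous_map_real_divide
           pr mc t continuous_map_canonical_const ne)
  qed (simp add: radial_push_def)
  then have "continuous_map ?P (powertop_real UNIV) (\<lambda>(t,x). radial_push p t x)"
    by (simp add: continuous_map_componentwise_UNIV case_prod_unfold)
  then show ?thesis
    unfolding continuous_map_in_subtopology
    using radial_push_in_simplex radial_push_not_barycenter by fastforce
qed

section \<open>Attaching a cell\<close>

locale cell_attachment =
  fixes p :: nat and X :: "'a topology" and A :: "'a set" and \<sigma> :: "(nat \<Rightarrow> real) \<Rightarrow> 'a"
  assumes haus: "Hausdorff_space X"
    and closed: "closedin X A"
    and cont: "continuous_map (simplex_space p) X \<sigma>"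
    and bd: "\<sigma> ` simplex_bd p \<subseteq> A"
    and inj: "inj_on \<sigma> (standard_simplex p - simplex_bd p)"
    and disj: "\<sigma> ` (standard_simplex p - simplex_bd p) \<inter> A = {}"
    and cover: "topspace X = A \<union> \<sigma> ` standard_simplex p"
begin

definition center :: 'a where "center = \<sigma> (barycenter p)"

definition punctured :: "'a topology" where
  "punctured = subtopology X (- {center})"

definition cell_coord :: "'a \<Rightarrow> nat \<Rightarrow> real" where
  "cell_coord y = (SOME x. x \<in> standard_simplex p \<and> \<sigma> x = y)"

definition push :: "real \<times> 'a \<Rightarrow> 'a" where
  "push = (\<lambda>(t,y). if y \<in> A then y else \<sigma> (radial_push p t (cell_coord y)))"

lemma center_notin: "center \<notin> A"
  using disj barycenter_in_simplex by (auto simp: center_def)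

lemma eq_center_iff: "x \<in> standard_simplex p \<Longrightarrow> \<sigma> x = center \<longleftrightarrow> x = barycenter p"
  using bd center_notin barycenter_in_simplex [of p] inj_onD [OF inj, of x "barycenter p"]
  by (fastforce simp: center_def)

lemma topspace_punctured: "topspace punctured = A \<union> \<sigma> ` (standard_simplex p - {barycenter p})"
  using cover center_notin eq_center_iff by (auto simp: punctured_def)

lemma push_on: "y \<in> A \<Longrightarrow> push (t,y) = y"
  by (simp add: push_def)

lemma push_cell:
  assumes x: "x \<in> standard_simplex p"
  shows "push (t, \<sigma> x) = \<sigma> (radial_push p t x)"
proof (cases "x \<in> simplex_bd p")
  case True
  then show ?thesis using bd by (auto simp: push_def radial_push_bd)
next
  case False
  then have nA: "\<sigma> x \<notin> A" using disj x by auto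
  have "cell_coord (\<sigma> x) \<in> standard_simplex p \<and> \<sigma> (cell_coord (\<sigma> x)) = \<sigma> x"
    unfolding cell_coord_def by (rule someI [of _ x]) (use x in simp)
  moreover from this have "cell_coord (\<sigma> x) \<notin> simplex_bd p" using nA bd by force
  ultimately have "cell_coord (\<sigma> x) = x"
    using x False by (intro inj_onD [OF inj]) auto
  then show ?thesis using nA by (simp add: push_def)
qed

lemma closed_map_cell: "closed_map (simplex_space p) X \<sigma>"
  by (intro T1_Spaces.continuous_imp_closed_map cont haus compact_space_subtopology compactin_standard_simplex)

lemma closed_map_punctured_prod:
  "closed_map (prod_topology (top_of_set {0..1::real}) (subtopology (simplex_space p) (- {barycenter p})))
     (prod_topology (top_of_set {0..1}) punctured) (\<lambda>(t,x). (t, \<sigma> x))"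
proof -
  let ?I = "top_of_set {0..1::real}"
  have "continuous_map (prod_topology ?I (simplex_space p)) (prod_topology ?I X) (\<lambda>(t,x). (t, \<sigma> x))"
    using continuous_map_prod_top [of ?I "simplex_space p" ?I X id \<sigma>] cont by simp
  moreover have "compact_space (prod_topology ?I (simplex_space p))"
    by (simp add: compact_space_prod_topology compact_space_subtopology compactin_standard_simplex)
  moreover have "Hausdorff_space (prod_topology ?I X)"
    by (simp add: Hausdorff_space_prod_topology Hausdorff_space_subtopology haus)
  ultimately have "closed_map (prod_topology ?I (simplex_space p)) (prod_topology ?I X) (\<lambda>(t,x). (t, \<sigma> x))"
    by (rule T1_Spaces.continuous_imp_closed_map)
  then have "closed_map (subtopology (prod_topology ?I (simplex_space p)) ({0..1} \<times> (standard_simplex p - {barycenter p})))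
       (subtopology (prod_topology ?I X) ({0..1} \<times> - {center})) (\<lambda>(t,x). (t, \<sigma> x))"
    by (rule closed_map_restriction) (auto simp: eq_center_iff)
  moreover have "subtopology (prod_topology ?I (simplex_space p)) ({0..1} \<times> (standard_simplex p - {barycenter p}))
    = prod_topology ?I (subtopology (simplex_space p) (- {barycenter p}))"
    by (simp add: prod_topology_subtopology(2) subtopology_subtopology Times_Int_Times Diff_eq Int_left_absorb)
  moreover have "subtopology (prod_topology ?I X) ({0..1} \<times> - {center}) = prod_topology ?I punctured"
    by (simp add: punctured_def prod_topology_subtopology(2) subtopology_subtopology Times_Int_Times)
  ultimately show ?thesis by simp
qed

lemma continuous_map_push:
  "continuous_map (prod_topology (top_of_set {0..1}) punctured) punctured push"
proof -
  let ?I = "top_of_set {0..1::real}" and ?D = "subtopology (simplex_space p) (- {barycenter p})"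
  let ?q = "\<lambda>(t::real,x). (t, \<sigma> x)"
  have cD: "continuous_map ?D punctured \<sigma>"
    unfolding punctured_def continuous_map_in_subtopology
    using continuous_map_from_subtopology [OF cont] eq_center_iff by auto
  have cr: "continuous_map (prod_topology ?I ?D) punctured (\<lambda>z. \<sigma> (case z of (t,x) \<Rightarrow> radial_push p t x))"
    using continuous_map_compose [OF continuous_map_radial_push cD] by (simp add: o_def)
  show ?thesis
    unfolding continuous_map_closedin
  proof (intro conjI allI impI)
    show "push \<in> topspace (prod_topology ?I punctured) \<rightarrow> topspace punctured"
    proof (clarsimp simp: topspace_punctured)
      fix t :: real and y
      assume t: "0 \<le> t" "t \<le> 1" and "y \<in> A \<or> y \<in> \<sigma> ` (standard_simplex p - {barycenter p})"
        and n: "push (t,y) \<notin> \<sigma> ` (standard_simplex p - {barycenter p})"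
      then show "push (t,y) \<in> A"
        using radial_push_in_simplex [of _ p t] radial_push_not_barycenter [of _ p t] 
        by (auto simp: push_on push_cell)
    qed
  next
    fix C assume C: "closedin punctured C"
    let ?R = "{z \<in> topspace (prod_topology ?I ?D). \<sigma> (case z of (t,x) \<Rightarrow> radial_push p t x) \<in> C}"
    have "closedin punctured A"
      using closed center_notin closedin_subset [OF closed]
      unfolding punctured_def closedin_subtopology by blast
    then have "closedin punctured (A \<inter> C)" using C by blast
    then have 1: "closedin (prod_topology ?I punctured)
         {z \<in> topspace (prod_topology ?I punctured). snd z \<in> A \<inter> C}"
      by (rule closedin_continuous_map_preimage [OF continuous_map_snd])
    have "closedin (prod_topology ?I ?D) ?R"
      by (rule closedin_continuous_map_preimage [OF cr C])
    then have 2: "closedin (prod_topology ?I punctured) (?q ` ?R)"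
      using closed_map_punctured_prod unfolding closed_map_def by blast
    have "{z \<in> topspace (prod_topology ?I punctured). push z \<in> C} =
          {z \<in> topspace (prod_topology ?I punctured). snd z \<in> A \<inter> C} \<union> ?q ` ?R" (is "?L = ?M \<union> ?N")
    proof (intro equalityI subsetI)
      fix z assume z: "z \<in> ?L"
      obtain t y where ty: "z = (t,y)" by fastforce
      show "z \<in> ?M \<union> ?N"
      proof (cases "y \<in> A")
        case True
        then show ?thesis using z ty by (auto simp: push_on)
      next
        case False
        then obtain x where x: "x \<in> standard_simplex p" "x \<noteq> barycenter p" "y = \<sigma> x"
          using z ty by (auto simp: topspace_punctured)
        then have "(t,x) \<in> ?R" using z ty by (auto simp: push_cell)
        then show ?thesis using x ty by force
      qed
    next
      fix z assume "z \<in> ?M \<union> ?N"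
      then show "z \<in> ?L"
        by (auto simp: push_on push_cell topspace_punctured)
    qed
    then show "closedin (prod_topology ?I punctured) {z \<in> topspace (prod_topology ?I punctured). push z \<in> C}"
      using 1 2 by auto
  qed
qed

lemma trivial_relative_homology_punctured: "trivial_group (relative_homology_group k punctured A)"
proof (rule trivial_relative_homology_group_gen)
  let ?f = "\<lambda>y. push (1,y)"
  let ?I = "top_of_set {0..1::real}"
  have c: "continuous_map punctured punctured ?f"
  proof -
    have "continuous_map punctured (prod_topology ?I punctured) (\<lambda>y. (1,y))"
      by (simp add: continuous_map_pairwise o_def)
    then show ?thesis
      using continuous_map_compose [OF _ continuous_map_push] by (fastforce simp: o_def)
  qed
  have im: "?f y \<in> A" if y: "y \<in> topspace punctured" for y
  proof -
    consider "y \<in> A" | x where "x \<in> standard_simplex p" "x \<noteq> barycenter p" "y = \<sigma> x"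
      using y by (auto simp: topspace_punctured)
    then show ?thesis
      by cases (use radial_push_1 bd in \<open>auto simp: push_on push_cell\<close>)
  qed
  show "continuous_map punctured (subtopology punctured A) ?f"
    using c im by (auto simp: continuous_map_in_subtopology)
  have "continuous_map (subtopology punctured A) (subtopology punctured A) ?f"
    using c im by (auto simp: continuous_map_in_subtopology intro: continuous_map_from_subtopology)
  then show "homotopic_with (\<lambda>h. True) (subtopology punctured A) (subtopology punctured A) ?f id"
    by (intro homotopic_with_equal) (auto simp: push_on)
  have "homotopic_with (\<lambda>h. True) punctured punctured id ?f"
    unfolding homotopic_with_def
  proof (intro exI conjI ballI allI)
    show "continuous_map (prod_topology ?I punctured) punctured (\<lambda>z. if fst z = 0 then snd z else push z)"
    proof (rule continuous_map_eq [OF continuous_map_push])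
      fix z assume "z \<in> topspace (prod_topology ?I punctured)"
      then show "push z = (if fst z = 0 then snd z else push z)"
        by (cases z) (auto simp: topspace_punctured push_on push_cell radial_push_0)
    qed
  qed auto
  then show "homotopic_with (\<lambda>h. True) punctured punctured ?f id"
    by (rule homotopic_with_symD)
qed

lemma iso_punctured: 
  "hom_induced k X A X (topspace punctured) id \<in> iso (relative_homology_group k X A) (relative_homology_group k X (topspace punctured))"
proof (rule iso_hom_induced_triple)
  show "A \<subseteq> topspace punctured" by (auto simp: topspace_punctured)
  have "subtopology X (topspace punctured) = punctured"
    unfolding punctured_def by (metis subtopology_restrict topspace_subtopology)
  then show "trivial_group (relative_homology_group k (subtopology X (topspace punctured)) A)" for k
    by (simp add: trivial_relative_homology_punctured)
qed

lemma iso_excised: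
  "hom_induced k (subtopology X (topspace X - A)) (topspace punctured - A) X (topspace punctured) id
    \<in> iso (relative_homology_group k (subtopology X (topspace X - A)) (topspace punctured - A))
          (relative_homology_group k X (topspace punctured))"
proof -
  have "closedin X {center}"
    using closedin_Hausdorff_singleton [OF haus] cover barycenter_in_simplex by (auto simp: center_def)
  then have o: "openin X (topspace punctured)"
    by (auto simp: punctured_def openin_closedin_eq Diff_eq [symmetric] Diff_Diff_Int)
  have "hom_induced k (subtopology X (topspace X - A)) (topspace punctured - A) (subtopology X (topspace X)) (topspace punctured) id
    \<in> iso (relative_homology_group k (subtopology X (topspace X - A)) (topspace punctured - A))
          (relative_homology_group k (subtopology X (topspace X)) (topspace punctured))"
  proof (rule homology_excision_axiom)
    show "X closure_of A \<subseteq> X interior_of topspace punctured"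
      using closed o by (simp add: closure_of_closedin interior_of_openin topspace_punctured)
    show "topspace punctured \<subseteq> topspace X" by (auto simp: punctured_def)
  qed
  then show ?thesis by simp
qed

lemma homeomorphic_map_cell:
  "homeomorphic_map (subtopology (simplex_space p) (standard_simplex p - simplex_bd p)) (subtopology X (topspace X - A)) \<sigma>"
proof (rule bijective_closed_imp_homeomorphic_map)
  have eq: "{x \<in> topspace (simplex_space p). \<sigma> x \<in> topspace X - A} = standard_simplex p - simplex_bd p"
    using bd disj cover by auto
  show "closed_map (subtopology (simplex_space p) (standard_simplex p - simplex_bd p)) (subtopology X (topspace X - A)) \<sigma>"
    by (rule closed_map_restriction [OF closed_map_cell eq])
  show "continuous_map (subtopology (simplex_space p) (standard_simplex p - simplex_bd p)) (subtopology X (topspace X - A)) \<sigma>"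
    unfolding continuous_map_in_subtopology
    using continuous_map_from_subtopology [OF cont] eq by auto
  show "\<sigma> ` topspace (subtopology (simplex_space p) (standard_simplex p - simplex_bd p)) = topspace (subtopology X (topspace X - A))"
    using eq cover by auto
  show "inj_on \<sigma> (topspace (subtopology (simplex_space p) (standard_simplex p - simplex_bd p)))"
    using inj by (rule inj_on_subset) auto
qed

end

lemma Hausdorff_simplex_space: "Hausdorff_space (simplex_space p)"
  by (intro Hausdorff_space_subtopology) (simp add: Hausdorff_space_product_topology)

lemma closedin_faces:
  assumes "finite I"
  shows "closedin (simplex_space p) {x \<in> standard_simplex p. \<exists>i\<in>I. x i = 0}"
proof -
  have "closedin (simplex_space p) {x \<in> topspace (simplex_space p). x i \<in> {0}}" for i
    by (rule closedin_continuous_map_preimage [OF continuous_map_from_subtopology [OF continuous_map_coord]]) auto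
  then have "closedin (simplex_space p) (\<Union>i\<in>I. {x \<in> topspace (simplex_space p). x i \<in> {0}})"
    using assms by (intro closedin_Union) auto
  moreover have "(\<Union>i\<in>I. {x \<in> topspace (simplex_space p). x i \<in> {0}}) = {x \<in> standard_simplex p. \<exists>i\<in>I. x i = 0}"
    by auto
  ultimately show ?thesis by simp
qed

lemma closedin_simplex_bd: "closedin (simplex_space p) (simplex_bd p)"
  using closedin_faces [of "{..p}" p] unfolding simplex_bd_def by (simp only: Bex_def atMost_iff finite_atMost)

lemma cell_attachment_id: "cell_attachment p (simplex_space p) (simplex_bd p) id"
proof
  show "closedin (simplex_space p) (simplex_bd p)" by (rule closedin_simplex_bd)
qed (auto simp: Hausdorff_simplex_space simplex_bd_def)

context cell_attachment
begin

lemma iso_cell: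
  "hom_induced k (simplex_space p) (simplex_bd p) X A \<sigma>
     \<in> iso (relative_homology_group k (simplex_space p) (simplex_bd p)) (relative_homology_group k X A)"
proof -
  let ?D = "simplex_space p" and ?B = "simplex_bd p"
  interpret I: cell_attachment p ?D ?B id by (rule cell_attachment_id)
  define V where "V = topspace I.punctured"
  define W where "W = topspace punctured"
  have V: "V = standard_simplex p - {barycenter p}"
    using barycenter_in_simplex [of p] by (auto simp: V_def I.topspace_punctured simplex_bd_def)
  have W: "W = A \<union> \<sigma> ` V" by (simp add: W_def topspace_punctured V)
  let ?D' = "subtopology ?D (topspace ?D - ?B)" and ?X' = "subtopology X (topspace X - A)"
  have "?B \<subseteq> V" by (auto simp: V_def I.topspace_punctured)
  have hom: "homeomorphic_map ?D' ?X' \<sigma>"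
    using homeomorphic_map_cell by simp
  have im: "\<sigma> ` (V - ?B) = W - A"
    using bd disj unfolding W V by auto
  have h1: "hom_induced k ?D' (V - ?B) ?X' (W - A) \<sigma>
      \<in> iso (relative_homology_group k ?D' (V - ?B)) (relative_homology_group k ?X' (W - A))"
    by (rule homeomorphic_map_relative_homology_iso [OF hom _ im]) (auto simp: V)
  have gP: "hom_induced k ?D' (V - ?B) ?D V id
      \<in> iso (relative_homology_group k ?D' (V - ?B)) (relative_homology_group k ?D V)"
    using I.iso_excised unfolding V_def .
  have gX: "hom_induced k ?X' (W - A) X W id
      \<in> iso (relative_homology_group k ?X' (W - A)) (relative_homology_group k X W)"
    using iso_excised unfolding W_def .
  have jP: "hom_induced k ?D ?B ?D V id \<in> iso (relative_homology_group k ?D ?B) (relative_homology_group k ?D V)"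
    using I.iso_punctured unfolding V_def .
  have jX: "hom_induced k X A X W id \<in> iso (relative_homology_group k X A) (relative_homology_group k X W)"
    using iso_punctured unfolding W_def .
  have c': "continuous_map ?D' ?X' \<sigma>" using hom by (rule homeomorphic_imp_continuous_map)
  have h2: "hom_induced k ?D V X W \<sigma> \<in> iso (relative_homology_group k ?D V) (relative_homology_group k X W)"
  proof (rule iso_factor_left [OF gP iso_set_trans [OF h1 gX] hom_induced_hom])
    fix x 
    have "hom_induced k ?D V X W \<sigma> (hom_induced k ?D' (V - ?B) ?D V id x) = hom_induced k ?D' (V - ?B) X W (\<sigma> \<circ> id) x"
      by (rule hom_induced_compose') (use cont W in auto)
    also have "\<dots> = hom_induced k ?D' (V - ?B) X W (id \<circ> \<sigma>) x" by simp
    also have "\<dots> = hom_induced k ?X' (W - A) X W id (hom_induced k ?D' (V - ?B) ?X' (W - A) \<sigma> x)"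
      by (rule hom_induced_compose' [symmetric]) (use c' im in auto)
    finally show "hom_induced k ?D V X W \<sigma> (hom_induced k ?D' (V - ?B) ?D V id x) =
        (hom_induced k ?X' (W - A) X W id \<circ> hom_induced k ?D' (V - ?B) ?X' (W - A) \<sigma>) x"
      by simp
  qed
  show ?thesis
  proof (rule iso_factor_right [OF jX iso_set_trans [OF jP h2] hom_induced_hom])
    fix x
    have "hom_induced k X A X W id (hom_induced k ?D ?B X A \<sigma> x) = hom_induced k ?D ?B X W (id \<circ> \<sigma>) x"
      by (rule hom_induced_compose') (use cont bd W in auto)
    also have "\<dots> = hom_induced k ?D ?B X W (\<sigma> \<circ> id) x" by simp
    also have "\<dots> = hom_induced k ?D V X W \<sigma> (hom_induced k ?D ?B ?D V id x)"
      by (rule hom_induced_compose' [symmetric]) (use cont \<open>?B \<subseteq> V\<close> W in auto)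
    finally show "hom_induced k X A X W id (hom_induced k ?D ?B X A \<sigma> x) =
        (hom_induced k ?D V X W \<sigma> \<circ> hom_induced k ?D ?B ?D V id) x"
      by simp
  qed
qed

end

definition simplex_horn :: "nat \<Rightarrow> (nat \<Rightarrow> real) set" where
  "simplex_horn p = {x \<in> standard_simplex p. \<exists>i\<in>{1..p}. x i = 0}"

lemma simplex_horn_subset_bd: "simplex_horn p \<subseteq> simplex_bd p"
  by (auto simp: simplex_horn_def simplex_bd_def)

lemma homotopic_star_vertex:
  fixes S :: "(nat \<Rightarrow> real) set"
  defines "v \<equiv> (\<lambda>j. if j = 0 then 1 else 0)"
  assumes "\<And>x t. \<lbrakk>x \<in> S; 0 \<le> t; t \<le> 1\<rbrakk> \<Longrightarrow> (\<lambda>i. (1 - t) * v i + t * x i) \<in> S"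
  shows "homotopic_with (\<lambda>h. True) (subtopology (powertop_real UNIV) S) (subtopology (powertop_real UNIV) S) (\<lambda>x. v) id"
  unfolding homotopic_with_def
proof (intro exI conjI ballI allI)
  let ?P = "prod_topology (top_of_set {0..1::real}) (subtopology (powertop_real UNIV) S)"
  let ?h = "\<lambda>z i. (1 - fst z) * v i + fst z * snd z i"
  have pr: "continuous_map ?P euclideanreal (\<lambda>z. snd z i)" for i
    by (intro continuous_map_compose [OF continuous_map_snd, unfolded o_def] continuous_map_from_subtopology
        continuous_map_coord)
  have t: "continuous_map ?P euclideanreal fst"
    using continuous_map_fst continuous_map_into_fulltopology by blast
  have "continuous_map ?P (powertop_real UNIV) ?h"
    unfolding continuous_map_componentwise_UNIV
    by (intro allI continuous_map_add continuous_map_real_mult continuous_map_diff pr t continuous_map_canonical_const)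
  then show "continuous_map ?P (subtopology (powertop_real UNIV) S) ?h"
    using assms(2) by (auto simp: continuous_map_in_subtopology)
qed auto

lemma trivial_relative_homology_horn:
  assumes "1 \<le> p"
  shows "trivial_group (relative_homology_group k (simplex_space p) (simplex_horn p))"
proof -
  define v :: "nat \<Rightarrow> real" where "v = (\<lambda>j. if j = 0 then 1 else 0)"
  have v: "v \<in> standard_simplex p" unfolding v_def by simp
  have vh: "v \<in> simplex_horn p" using v assms by (force simp: simplex_horn_def v_def)
  have conv: "(\<lambda>i. (1 - t) * v i + t * x i) \<in> standard_simplex p"
    if "x \<in> standard_simplex p" "0 \<le> t" "t \<le> 1" for x t
    using convex_standard_simplex [OF v that] .
  have eq: "subtopology (simplex_space p) (simplex_horn p) = subtopology (powertop_real UNIV) (simplex_horn p)"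
    by (simp add: subtopology_subtopology simplex_horn_def Int_absorb1 Collect_restrict)
  show ?thesis
  proof (rule trivial_relative_homology_group_gen)
    show "continuous_map (simplex_space p) (subtopology (simplex_space p) (simplex_horn p)) (\<lambda>x. v)"
      using v vh by simp
    show "homotopic_with (\<lambda>h. True) (simplex_space p) (simplex_space p) (\<lambda>x. v) id"
      unfolding v_def by (rule homotopic_star_vertex) (use conv in \<open>simp add: v_def\<close>)
    show "homotopic_with (\<lambda>h. True) (subtopology (simplex_space p) (simplex_horn p)) (subtopology (simplex_space p) (simplex_horn p)) (\<lambda>x. v) id"
      unfolding eq unfolding v_def
      by (rule homotopic_star_vertex) (use conv in \<open>fastforce simp: v_def simplex_horn_def\<close>)
  qed
qed

lemma cell_attachment_front_face:
  "cell_attachment p (subtopology (simplex_space (Suc p)) (simplex_bd (Suc p))) (simplex_horn (Suc p)) (simplical_face 0)"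
proof
  let ?Y = "subtopology (simplex_space (Suc p)) (simplex_bd (Suc p))"
  have in_simp: "simplical_face 0 x \<in> standard_simplex (Suc p)" if "x \<in> standard_simplex p" for x :: "nat \<Rightarrow> real"
    using simplical_face_in_standard_simplex [of "Suc p" 0 x] that by simp
  show "Hausdorff_space ?Y" by (intro Hausdorff_space_subtopology Hausdorff_simplex_space)
  have "closedin (simplex_space (Suc p)) (simplex_horn (Suc p))"
    unfolding simplex_horn_def by (rule closedin_faces) simp
  then show "closedin ?Y (simplex_horn (Suc p))"
    by (rule closedin_subset_topspace) (rule simplex_horn_subset_bd)
  have "continuous_map (simplex_space p) (powertop_real UNIV) (simplical_face 0)"
    unfolding continuous_map_componentwise_UNIV
  proof
    fix k show "continuous_map (simplex_space p) euclideanreal (\<lambda>x. simplical_face 0 x k)"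
      by (cases k) (auto simp: simplical_face_def intro: continuous_map_from_subtopology continuous_map_coord)
  qed
  then show "continuous_map (simplex_space p) ?Y (simplical_face 0)"
    using in_simp by (auto simp: continuous_map_in_subtopology simplex_bd_def simplical_face_def intro!: exI [of _ 0])
  show "simplical_face 0 ` simplex_bd p \<subseteq> simplex_horn (Suc p)"
  proof (rule image_subsetI)
    fix x :: "nat \<Rightarrow> real" assume x: "x \<in> simplex_bd p"
    then obtain i where "i \<le> p" "x i = 0" by (auto simp: simplex_bd_def)
    then have "simplical_face 0 x (Suc i) = 0" "Suc i \<in> {1..Suc p}" by (auto simp: simplical_face_def)
    then show "simplical_face 0 x \<in> simplex_horn (Suc p)"
      using x in_simp unfolding simplex_bd_def simplex_horn_def by blast
  qed
  show "inj_on (simplical_face 0) (standard_simplex p - simplex_bd p)"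
  proof
    fix x y :: "nat \<Rightarrow> real" assume "simplical_face 0 x = simplical_face 0 y"
    then have "simplical_face 0 x (Suc i) = simplical_face 0 y (Suc i)" for i by simp
    then show "x = y" by (auto simp: simplical_face_def)
  qed
  show "simplical_face 0 ` (standard_simplex p - simplex_bd p) \<inter> simplex_horn (Suc p) = {}"
  proof -
    have "\<exists>i\<le>p. x i = 0" if "i \<in> {1..Suc p}" "simplical_face 0 x i = 0" for x :: "nat \<Rightarrow> real" and i
      using that by (intro exI [of _ "i - 1"]) (auto simp: simplical_face_def)
    then show ?thesis by (auto simp: simplex_bd_def simplex_horn_def)
  qed
  show "topspace ?Y = simplex_horn (Suc p) \<union> simplical_face 0 ` standard_simplex p"
  proof (intro equalityI subsetI)
    fix y assume y: "y \<in> topspace ?Y"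
    show "y \<in> simplex_horn (Suc p) \<union> simplical_face 0 ` standard_simplex p"
    proof (cases "y \<in> simplex_horn (Suc p)")
      case False
      with y obtain i where "i \<le> Suc p" "y i = 0" "\<not> (1 \<le> i \<and> i \<le> Suc p)"
        by (auto simp: simplex_bd_def simplex_horn_def)
      then have y0: "y 0 = 0" by (cases i) auto
      have ys: "y \<in> standard_simplex (Suc p)" using y by simp
      have "(\<lambda>i. y (Suc i)) \<in> standard_simplex p"
        using ys y0 by (auto simp: standard_simplex_def sum.atMost_Suc_shift simp del: sum.atMost_Suc)
      moreover have "y = simplical_face 0 (\<lambda>i. y (Suc i))"
        using y0 by (auto simp: simplical_face_def)
      ultimately show ?thesis by blast
    qed simp
  next
    fix y assume "y \<in> simplex_horn (Suc p) \<union> simplical_face 0 ` standard_simplex p"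
    moreover have "simplical_face 0 x \<in> simplex_bd (Suc p)" if "x \<in> standard_simplex p" for x :: "nat \<Rightarrow> real"
      using in_simp [OF that] by (auto simp: simplex_bd_def simplical_face_def intro!: exI [of _ 0])
    ultimately have "y \<in> simplex_bd (Suc p)"
      using simplex_horn_subset_bd [of "Suc p"] by auto
    then show "y \<in> topspace ?Y" by (simp add: simplex_bd_def)
  qed
qed

section \<open>Homology of the simplex modulo its boundary\<close>

lemma hom_relboundary_chain_boundary:
  assumes c: "singular_relcycle (Suc p) X S c" and "T \<subseteq> S"
  shows "hom_relboundary (1 + int p) X S T (homologous_rel_set (Suc p) X S c)
       = homologous_rel_set p (subtopology X S) T (chain_boundary (Suc p) c)"
proof -
  have b: "hom_boundary (1 + int p) X S (homologous_rel_set (Suc p) X S c)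
      = homologous_rel_set p (subtopology X S) {} (chain_boundary (Suc p) c)"
    using hom_boundary_chain_boundary [OF c] by simp
  have cyc: "singular_relcycle p (subtopology X S) {} (chain_boundary (Suc p) c)"
    using c chain_boundary_boundary_alt [of p X c] by (auto simp: singular_relcycle singular_cycle)
  have "chain_map p id (chain_boundary (Suc p) c) = chain_boundary (Suc p) c"
    using cyc by (intro chain_map_ident) (auto simp: singular_cycle)
  then have "hom_induced (int p) (subtopology X S) {} (subtopology X S) T id
       (homologous_rel_set p (subtopology X S) {} (chain_boundary (Suc p) c))
     = homologous_rel_set p (subtopology X S) T (chain_boundary (Suc p) c)"
    using hom_induced_chain_map [OF continuous_map_id _ cyc, of T] by simp
  then show ?thesis by (simp add: hom_relboundary_def b)
qed

definition simplex_id :: "nat \<Rightarrow> (nat \<Rightarrow> real) \<Rightarrow> nat \<Rightarrow> real" where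
  "simplex_id p = restrict id (standard_simplex p)"

lemma singular_simplex_simplex_id: "singular_simplex p (simplex_space p) (simplex_id p)"
  unfolding simplex_id_def by (rule simplicial_imp_singular_simplex) simp

lemma singular_face_simplex_id:
  assumes "k \<le> Suc p"
  shows "singular_face (Suc p) k (simplex_id (Suc p)) = restrict (simplical_face k) (standard_simplex p)"
  using assms simplical_face_in_standard_simplex [of "Suc p" k]
  by (auto simp: singular_face_def simplex_id_def fun_eq_iff restrict_def)

lemma singular_simplex_face_simplex_id:
  assumes "k \<le> Suc p"
  shows "singular_simplex p (subtopology (simplex_space (Suc p)) {x \<in> standard_simplex (Suc p). x k = 0})
           (singular_face (Suc p) k (simplex_id (Suc p)))"
proof -
  have "singular_simplex p (simplex_space (Suc p)) (singular_face (Suc p) k (simplex_id (Suc p)))"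
    using singular_simplex_singular_face [OF singular_simplex_simplex_id, of "Suc p" k] assms by simp
  then show ?thesis
    unfolding singular_simplex_subtopology [of _ "simplex_space (Suc p)"]
    using simplical_face_in_standard_simplex [of "Suc p" k] assms
    by (auto simp: singular_face_simplex_id simplical_face_def)
qed

lemma singular_relcycle_simplex_id:
  "singular_relcycle p (simplex_space p) (simplex_bd p) (frag_of (simplex_id p))"
proof (cases p)
  case 0
  then show ?thesis
    by (simp add: singular_relcycle singular_chain_of singular_simplex_simplex_id chain_boundary_def)
next
  case (Suc q)
  have "singular_simplex q (subtopology (simplex_space p) (simplex_bd p)) (singular_face p k (simplex_id p))"
    if "k \<le> p" for k
    using singular_simplex_face_simplex_id [of k q] that Suc 
    by (auto simp: simplex_bd_def elim!: singular_simplex_mono)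
  then show ?thesis
    using Suc by (auto simp: singular_relcycle singular_chain_of singular_simplex_simplex_id chain_boundary_of
        intro!: singular_chain_sum singular_chain_cmul simp del: sum.atMost_Suc)
qed

lemma trivial_group_iso_iff:
  assumes "h \<in> iso G H" "group G" "group H"
  shows "trivial_group G \<longleftrightarrow> trivial_group H"
  using assms isomorphic_group_triviality is_isoI by blast

lemma homology_simplex_mod_boundary:
  "infinite_cyclic_gen (relative_homology_group p (simplex_space p) (simplex_bd p))
     (homologous_rel_set p (simplex_space p) (simplex_bd p) (frag_of (simplex_id p)))"
  "k \<noteq> int p \<Longrightarrow> trivial_group (relative_homology_group k (simplex_space p) (simplex_bd p))"
proof -
  have "infinite_cyclic_gen (relative_homology_group p (simplex_space p) (simplex_bd p))
     (homologous_rel_set p (simplex_space p) (simplex_bd p) (frag_of (simplex_id p))) \<and>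
    (\<forall>k. k \<noteq> int p \<longrightarrow> trivial_group (relative_homology_group k (simplex_space p) (simplex_bd p)))"
  proof (induction p)
    case 0
    have bd: "simplex_bd 0 = {}" by (auto simp: simplex_bd_def standard_simplex_def)
    have pc: "path_connected_space (simplex_space 0)"
      using path_connectedin_standard_simplex by (simp add: path_connectedin_def)
    have "(\<lambda>n::int. homologous_rel_set 0 (simplex_space 0) {} (frag_of (simplex_id 0)) [^]\<^bsub>homology_group 0 (simplex_space 0)\<^esub> n)
       \<in> iso integer_group (homology_group 0 (simplex_space 0))"
      by (rule iso_integer_zeroth_homology_group [OF pc singular_simplex_simplex_id])
    moreover have "homologous_rel_set 0 (simplex_space 0) {} (frag_of (simplex_id 0)) \<in> carrier (homology_group 0 (simplex_space 0))"
      using singular_relcycle_simplex_id [of 0] bd by (auto simp: carrier_relative_homology_group_0)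
    moreover have "trivial_group (homology_group k (simplex_space 0))" if "k \<noteq> 0" for k
      by (rule homology_dimension_axiom [OF _ that]) (simp add: standard_simplex_0)
    ultimately show ?case by (simp add: infinite_cyclic_gen_def bd)
  next
    case (Suc p)
    let ?S = "simplex_space (Suc p)" and ?B = "simplex_bd (Suc p)" and ?H = "simplex_horn (Suc p)"
    let ?Y = "subtopology ?S ?B" and ?z = "frag_of (simplex_id (Suc p))"
    interpret F: cell_attachment p ?Y ?H "simplical_face 0"
      by (rule cell_attachment_front_face)
    have rel: "hom_relboundary k ?S ?B ?H \<in> iso (relative_homology_group k ?S ?B) (relative_homology_group (k - 1) ?Y ?H)" for k
      by (rule iso_hom_relboundary_triple [OF simplex_horn_subset_bd]) (simp add: trivial_relative_homology_horn)
    have "trivial_group (relative_homology_group k ?S ?B)" if "k \<noteq> int (Suc p)" for k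
      using that Suc.IH trivial_group_iso_iff [OF rel, of k] trivial_group_iso_iff [OF F.iso_cell, of "k - 1"] by simp
    moreover have "infinite_cyclic_gen (relative_homology_group (1 + int p) ?S ?B) (homologous_rel_set (Suc p) ?S ?B ?z)"
    proof -
      let ?f = "frag_of (singular_face (Suc p) 0 (simplex_id (Suc p)))"
      have car: "homologous_rel_set (Suc p) ?S ?B ?z \<in> carrier (relative_homology_group (1 + int p) ?S ?B)"
        using singular_relcycle_simplex_id [of "Suc p"] carrier_relative_homology_group [of "Suc p" ?S ?B] by auto
      have "hom_relboundary (1 + int p) ?S ?B ?H (homologous_rel_set (Suc p) ?S ?B ?z) 
          = homologous_rel_set p ?Y ?H (chain_boundary (Suc p) ?z)"
        by (rule hom_relboundary_chain_boundary [OF singular_relcycle_simplex_id simplex_horn_subset_bd])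
      also have "\<dots> = homologous_rel_set p ?Y ?H ?f"
      proof -
        have "chain_boundary (Suc p) ?z - ?f =
           (\<Sum>k\<in>{1..Suc p}. frag_cmul ((-1) ^ k) (frag_of (singular_face (Suc p) k (simplex_id (Suc p)))))"
          by (simp add: chain_boundary_of atMost_atLeast0 sum.atLeast_Suc_atMost del: sum.cl_ivl_Suc)
        moreover have "singular_chain p (subtopology ?Y ?H) \<dots>"
        proof (intro singular_chain_sum singular_chain_cmul)
          fix k assume k: "k \<in> {1..Suc p}"
          have sub: "{x \<in> standard_simplex (Suc p). x k = 0} \<subseteq> ?H" using k by (auto simp: simplex_horn_def)
          have "singular_simplex p (subtopology ?S ?H) (singular_face (Suc p) k (simplex_id (Suc p)))"
            by (rule singular_simplex_mono [OF singular_simplex_face_simplex_id sub]) (use k in simp)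
          then show "singular_chain p (subtopology ?Y ?H) (frag_of (singular_face (Suc p) k (simplex_id (Suc p))))"
            using simplex_horn_subset_bd [of "Suc p"] 
            by (simp add: singular_chain_of subtopology_subtopology [of ?S] Int_absorb1)
        qed
        ultimately have "homologous_rel p ?Y ?H (chain_boundary (Suc p) ?z) ?f"
          unfolding homologous_rel_def by (simp add: singular_chain_imp_relboundary)
        then show ?thesis by (simp add: homologous_rel_set_eq)
      qed
      also have "\<dots> = hom_induced p (simplex_space p) (simplex_bd p) ?Y ?H (simplical_face 0)
             (homologous_rel_set p (simplex_space p) (simplex_bd p) (frag_of (simplex_id p)))"
      proof -
        have "simplex_map p (simplical_face 0) (simplex_id p) = singular_face (Suc p) 0 (simplex_id (Suc p))"
          unfolding singular_face_simplex_id [OF le0]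
          by (auto simp: simplex_map_def simplex_id_def restrict_def fun_eq_iff)
        then show ?thesis
          using hom_induced_chain_map [OF F.cont _ singular_relcycle_simplex_id, of ?H] F.bd by auto
      qed
      finally have eq: "hom_relboundary (1 + int p) ?S ?B ?H (homologous_rel_set (Suc p) ?S ?B ?z) = \<dots>" .
      have "infinite_cyclic_gen (relative_homology_group p ?Y ?H) \<dots>"
        using infinite_cyclic_gen_iso_iff [OF F.iso_cell, of _ p] Suc.IH by (simp add: infinite_cyclic_gen_def)
      then show ?thesis
        using infinite_cyclic_gen_iso_iff [OF rel car] eq by simp
    qed
    ultimately show ?case by simp
  qed
  then show "infinite_cyclic_gen (relative_homology_group p (simplex_space p) (simplex_bd p))
     (homologous_rel_set p (simplex_space p) (simplex_bd p) (frag_of (simplex_id p)))"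
   "k \<noteq> int p \<Longrightarrow> trivial_group (relative_homology_group k (simplex_space p) (simplex_bd p))"
    by auto
qed

definition cell_simplex :: "nat \<Rightarrow> ((nat \<Rightarrow> real) \<Rightarrow> 'a) \<Rightarrow> (nat \<Rightarrow> real) \<Rightarrow> 'a" where
  "cell_simplex p \<sigma> = restrict \<sigma> (standard_simplex p)"

context cell_attachment
begin

lemma trivial_relative_homology_cell: "k \<noteq> int p \<Longrightarrow> trivial_group (relative_homology_group k X A)"
  using trivial_group_iso_iff [OF iso_cell, of k] homology_simplex_mod_boundary(2) [of k p] by simp

lemma chain_map_simplex_id: "chain_map p \<sigma> (frag_of (simplex_id p)) = frag_of (cell_simplex p \<sigma>)"
  by (auto simp: simplex_map_def simplex_id_def cell_simplex_def intro!: arg_cong [where f = frag_of])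

lemma singular_relcycle_cell: "singular_relcycle p X A (frag_of (cell_simplex p \<sigma>))"
  using singular_relcycle_chain_map [OF singular_relcycle_simplex_id cont, of A] bd chain_map_simplex_id by auto

lemma infinite_cyclic_gen_cell:
  "infinite_cyclic_gen (relative_homology_group p X A) (homologous_rel_set p X A (frag_of (cell_simplex p \<sigma>)))"
proof -
  let ?z = "homologous_rel_set p (simplex_space p) (simplex_bd p) (frag_of (simplex_id p))"
  have "hom_induced p (simplex_space p) (simplex_bd p) X A \<sigma> ?z = homologous_rel_set p X A (frag_of (cell_simplex p \<sigma>))"
    using hom_induced_chain_map [OF cont _ singular_relcycle_simplex_id, of A] bd chain_map_simplex_id by auto
  then show ?thesis
    using infinite_cyclic_gen_iso_iff [OF iso_cell, of ?z p] homology_simplex_mod_boundary(1) [of p]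
    by (simp add: infinite_cyclic_gen_def)
qed

end

section \<open>Attaching cells in cancelling pairs\<close>

lemma infinite_cyclic_gen_homologous_minus:
  assumes "infinite_cyclic_gen (relative_homology_group (int p) X S) (homologous_rel_set p X S c)"
  shows "infinite_cyclic_gen (relative_homology_group (int p) X S) (homologous_rel_set p X S (- c))"
proof -
  have "homologous_rel_set p X S (- c) = uminus ` homologous_rel_set p X S c"
  proof (intro equalityI subsetI)
    fix b assume "b \<in> homologous_rel_set p X S (- c)"
    then have "singular_relboundary p X S (- c - b)" by (simp add: homologous_rel_def)
    then have "singular_relboundary p X S (- (- c - b))" by (simp only: singular_relboundary_minus)
    then have "- b \<in> homologous_rel_set p X S c" by (simp add: homologous_rel_def add.commute)
    then show "b \<in> uminus ` homologous_rel_set p X S c" by force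
  next
    fix b assume "b \<in> uminus ` homologous_rel_set p X S c"
    then obtain a where a: "b = - a" "singular_relboundary p X S (c - a)" by (auto simp: homologous_rel_def)
    then have "singular_relboundary p X S (- (c - a))" by (simp only: singular_relboundary_minus)
    then show "b \<in> homologous_rel_set p X S (- c)" using a by (simp add: homologous_rel_def)
  qed
  also have "\<dots> = inv\<^bsub>relative_homology_group (int p) X S\<^esub> (homologous_rel_set p X S c)"
    using assms by (simp add: inv_relative_homology_group infinite_cyclic_gen_def)
  finally show ?thesis
    using infinite_cyclic_gen_inv [OF assms] by simp
qed

lemma iso_hom_induced_subspace_triple:
  assumes "A \<subseteq> V0" "V0 \<subseteq> V1"
    and "\<And>k. trivial_group (relative_homology_group k (subtopology X V0) A)"
  shows "hom_induced k (subtopology X V1) A (subtopology X V1) V0 id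
     \<in> iso (relative_homology_group k (subtopology X V1) A) (relative_homology_group k (subtopology X V1) V0)"
  by (rule iso_hom_induced_triple) (use assms in \<open>simp_all add: subtopology_subtopology Int_absorb1\<close>)

lemma trivial_relative_homology_two_cells:
  assumes A: "A \<subseteq> V0" and triv: "\<And>k. trivial_group (relative_homology_group k (subtopology X V0) A)"
    and att1: "cell_attachment p (subtopology X V1) V0 \<sigma>"
    and att2: "cell_attachment (Suc p) (subtopology X V2) V1 \<tau>"
    and e: "e = 1 \<or> e = -1"
    and bdry: "singular_chain p (subtopology X V0)
        (chain_boundary (Suc p) (frag_of (cell_simplex (Suc p) \<tau>)) - frag_cmul e (frag_of (cell_simplex p \<sigma>)))"
  shows "trivial_group (relative_homology_group k (subtopology X V2) A)"
proof -
  interpret C1: cell_attachment p "subtopology X V1" V0 \<sigma> by fact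
  interpret C2: cell_attachment "Suc p" "subtopology X V2" V1 \<tau> by fact
  have V: "V0 \<subseteq> V1" "V1 \<subseteq> V2"
    using closedin_subset [OF C1.closed] closedin_subset [OF C2.closed] by auto
  have sub: "subtopology (subtopology X V2) V1 = subtopology X V1"
     "subtopology (subtopology X V1) V0 = subtopology X V0"
    using V by (simp_all add: subtopology_subtopology Int_absorb1)
  let ?X1 = "subtopology X V1" and ?X2 = "subtopology X V2"
  have iso0: "hom_relboundary k ?X2 V1 V0 \<in> iso (relative_homology_group k ?X2 V1) (relative_homology_group (k-1) ?X1 V0)" for k
  proof (cases "k = 1 + int p")
    case True
    let ?z = "homologous_rel_set (Suc p) ?X2 V1 (frag_of (cell_simplex (Suc p) \<tau>))"
    have "homologous_rel p ?X1 V0 (chain_boundary (Suc p) (frag_of (cell_simplex (Suc p) \<tau>))) 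
        (frag_cmul e (frag_of (cell_simplex p \<sigma>)))"
      unfolding homologous_rel_def
      by (rule singular_chain_imp_relboundary) (simp add: sub bdry)
    then have rb: "hom_relboundary (1 + int p) ?X2 V1 V0 ?z = homologous_rel_set p ?X1 V0 (frag_cmul e (frag_of (cell_simplex p \<sigma>)))"
      using hom_relboundary_chain_boundary [OF C2.singular_relcycle_cell V(1)] sub by (simp add: homologous_rel_set_eq)
    have "infinite_cyclic_gen (relative_homology_group (int p) ?X1 V0) (homologous_rel_set p ?X1 V0 (frag_cmul e (frag_of (cell_simplex p \<sigma>))))"
      using e C1.infinite_cyclic_gen_cell infinite_cyclic_gen_homologous_minus [OF C1.infinite_cyclic_gen_cell] by auto
    then show ?thesis
      using hom_gen_imp_iso [OF C2.infinite_cyclic_gen_cell, of "hom_relboundary k ?X2 V1 V0" "relative_homology_group (k-1) ?X1 V0"]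
        group_homomorphism_hom_relboundary [of k ?X2 V1 V0] True rb sub
      by simp
  next
    case False
    then show ?thesis
      using hom_trivial_imp_iso [OF C2.trivial_relative_homology_cell C1.trivial_relative_homology_cell, of k "k-1"]
       group_homomorphism_hom_relboundary [of k ?X2 V1 V0] sub by simp
  qed
  show ?thesis
  proof (rule trivial_relative_homology_group_triple [of A V1])
    fix k
    have j: "hom_induced (k-1) ?X1 A ?X1 V0 id \<in> iso (relative_homology_group (k-1) ?X1 A) (relative_homology_group (k-1) ?X1 V0)"
      by (rule iso_hom_induced_subspace_triple [OF A V(1) triv])
    have "hom_relboundary k ?X2 V1 A \<in> iso (relative_homology_group k ?X2 V1) (relative_homology_group (k - 1) ?X1 A)"
    proof (rule iso_factor_right [OF j iso0])
      show "hom_relboundary k ?X2 V1 A \<in> hom (relative_homology_group k ?X2 V1) (relative_homology_group (k - 1) ?X1 A)"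
        using group_homomorphism_hom_relboundary [of k ?X2 V1 A] sub by simp
      fix x assume x: "x \<in> carrier (relative_homology_group k ?X2 V1)"
      have "(hom_relboundary k ?X2 V1 V0 \<circ> hom_induced k ?X2 V1 ?X2 V1 id) x
          = (hom_induced (k-1) (subtopology ?X2 V1) A (subtopology ?X2 V1) V0 id \<circ> hom_relboundary k ?X2 V1 A) x"
        by (subst naturality_hom_induced_relboundary) (use A in auto)
      then show "hom_induced (k-1) ?X1 A ?X1 V0 id (hom_relboundary k ?X2 V1 A x) = hom_relboundary k ?X2 V1 V0 x"
        using hom_induced_id [OF x] sub by simp
    qed
    then show "hom_relboundary k ?X2 V1 A \<in> iso (relative_homology_group k ?X2 V1) (relative_homology_group (k - 1) (subtopology ?X2 V1) A)"
      by (simp add: sub)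
  qed (use A V in auto)
qed

lemma homology_cell_filtration:
  assumes att: "\<And>j. j < N \<Longrightarrow> cell_attachment (Suc j) (subtopology X (V (Suc j))) (V j) (\<sigma> (Suc j))"
    and e: "e = 1 \<or> e = -1"
    and bdry: "\<And>j. \<lbrakk>even j; Suc j < N\<rbrakk> \<Longrightarrow> singular_chain (Suc j) (subtopology X (V j))
        (chain_boundary (Suc (Suc j)) (frag_of (cell_simplex (Suc (Suc j)) (\<sigma> (Suc (Suc j)))))
          - frag_cmul e (frag_of (cell_simplex (Suc j) (\<sigma> (Suc j)))))"
    and V0: "V 0 \<subseteq> topspace X" and "j \<le> N"
  shows "even j \<Longrightarrow> trivial_group (relative_homology_group k (subtopology X (V j)) (V 0))" (is "_ \<Longrightarrow> ?T k j")
    and "odd j \<Longrightarrow> k \<noteq> int j \<Longrightarrow> trivial_group (relative_homology_group k (subtopology X (V j)) (V 0))"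
    and "odd j \<Longrightarrow> relative_homology_group j (subtopology X (V j)) (V 0) \<cong> integer_group"
proof -
  have V: "V i \<subseteq> V (Suc i)" if "i < N" for i
    using closedin_subset [OF cell_attachment.closed [OF att [OF that]]] by simp
  have mono: "V 0 \<subseteq> V i" if "i \<le> N" for i
    using that
  proof (induction i)
    case (Suc i)
    then show ?case using V [of i] by auto
  qed simp
  have ev: "?T k (2 * m)" if "2 * m \<le> N" for k m
    using that
  proof (induction m arbitrary: k)
    case 0
    have "topspace (subtopology X (V 0)) = V 0" using V0 by auto
    then show ?case using trivial_relative_homology_group_topspace [of k "subtopology X (V 0)"] by simp
  next
    case (Suc m)
    have att1: "cell_attachment (Suc (2 * m)) (subtopology X (V (Suc (2 * m)))) (V (2 * m)) (\<sigma> (Suc (2 * m)))"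
      and att2: "cell_attachment (Suc (Suc (2 * m))) (subtopology X (V (Suc (Suc (2 * m))))) (V (Suc (2 * m))) (\<sigma> (Suc (Suc (2 * m))))"
      using Suc.prems by (auto intro: att)
    have sub: "V 0 \<subseteq> V (2 * m)" using mono Suc.prems by simp
    have triv: "trivial_group (relative_homology_group k (subtopology X (V (2 * m))) (V 0))" for k
      using Suc.IH Suc.prems by simp
    have "?T k (Suc (Suc (2 * m)))"
      by (rule trivial_relative_homology_two_cells [OF sub triv att1 att2 e bdry]) (use Suc.prems in auto)
    then show ?case by simp
  qed
  show "even j \<Longrightarrow> ?T k j"
    using ev \<open>j \<le> N\<close> by (auto elim!: evenE)
  assume "odd j"
  then obtain m where m: "j = Suc (2 * m)" by (auto elim: oddE)
  interpret C: cell_attachment j "subtopology X (V j)" "V (2 * m)" "\<sigma> j"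
    using att [of "2 * m"] m \<open>j \<le> N\<close> by simp
  have i: "hom_induced k (subtopology X (V j)) (V 0) (subtopology X (V j)) (V (2 * m)) id
     \<in> iso (relative_homology_group k (subtopology X (V j)) (V 0)) (relative_homology_group k (subtopology X (V j)) (V (2 * m)))" for k
    using ev [of m] mono [of "2 * m"] V [of "2 * m"] m \<open>j \<le> N\<close> by (intro iso_hom_induced_subspace_triple) auto
  show "k \<noteq> int j \<Longrightarrow> trivial_group (relative_homology_group k (subtopology X (V j)) (V 0))"
    using trivial_group_iso_iff [OF i] C.trivial_relative_homology_cell by simp
  show "relative_homology_group j (subtopology X (V j)) (V 0) \<cong> integer_group"
    using is_isoI [OF i [of j]] infinite_cyclic_gen_imp_iso [OF C.infinite_cyclic_gen_cell] iso_trans by blast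
qed

section \<open>Points of the circle parametrised by simplices\<close>

definition psum :: "(nat \<Rightarrow> real) \<Rightarrow> nat \<Rightarrow> real" where
  "psum x i = (\<Sum>j<i. x j)"

definition circle_point :: "(nat \<Rightarrow> real) \<Rightarrow> nat \<Rightarrow> complex" where
  "circle_point x i = cis (2 * pi * psum x i)"

lemma psum_0 [simp]: "psum x 0 = 0" and psum_Suc: "psum x (Suc i) = psum x i + x i"
  by (simp_all add: psum_def)

lemma psum_simplex: "x \<in> standard_simplex p \<Longrightarrow> psum x (Suc p) = 1"
  by (simp add: psum_def standard_simplex_def lessThan_Suc_atMost)

lemma psum_face: "psum (simplical_face k x) i = psum x (if i \<le> k then i else i - 1)"
proof (induction i)
  case (Suc i)
  show ?case
  proof (cases "i \<le> k")
    case True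
    then show ?thesis using Suc by (auto simp: psum_Suc simplical_face_def)
  next
    case False
    then obtain l where "i = Suc l" by (cases i) auto
    then show ?thesis using Suc False by (auto simp: psum_Suc simplical_face_def)
  qed
qed simp

lemma circle_point_0 [simp]: "circle_point x 0 = 1"
  by (simp add: circle_point_def)

lemma circle_point_last: "x \<in> standard_simplex p \<Longrightarrow> circle_point x (Suc p) = 1"
  by (simp add: circle_point_def psum_simplex)

lemma circle_point_face:
  "circle_point (simplical_face k x) i = circle_point x (if i \<le> k then i else i - 1)"
  by (simp add: circle_point_def psum_face)

lemma bd_eq_face:
  assumes x: "x \<in> simplex_bd (Suc p)"
  obtains k y where "k \<le> Suc p" "y \<in> standard_simplex p" "x = simplical_face k y"
proof -
  obtain k where k: "k \<le> Suc p" "x k = 0" and xs: "x \<in> standard_simplex (Suc p)"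
    using x by (auto simp: simplex_bd_def)
  define y where "y = (\<lambda>i. if i < k then x i else x (Suc i))"
  have eq: "x = simplical_face k y"
    using k by (auto simp: simplical_face_def y_def fun_eq_iff)
  have "psum y (Suc p) = psum x (Suc (Suc p))"
    using k(1) unfolding eq psum_face by simp
  then have "(\<Sum>i\<le>p. y i) = 1"
    using psum_simplex [OF xs] by (simp add: psum_def lessThan_Suc_atMost)
  then have "y \<in> standard_simplex p"
    using xs k by (intro standard_simplexI) (auto simp: y_def standard_simplex_def)
  then show thesis using that k eq by blast
qed

lemma inj_on_cis_unit: "inj_on (\<lambda>t. cis (2 * pi * t)) {0..<1}"
proof
  fix s t :: real assume st: "s \<in> {0..<1}" "t \<in> {0..<1}" and "cis (2 * pi * s) = cis (2 * pi * t)"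
  then have "sin (2 * pi * s) = sin (2 * pi * t) \<and> cos (2 * pi * s) = cos (2 * pi * t)"
    by (simp add: complex_eq_iff)
  then obtain n :: int where "2 * pi * s = 2 * pi * t + 2 * pi * n"
    using sin_cos_eq_iff by blast
  then have "2 * pi * (s - t - n) = 0" by (simp add: algebra_simps)
  then have "s - t = n" by simp
  moreover have "\<bar>s - t\<bar> < 1" using st by auto
  ultimately have "n = 0" by linarith
  then show "s = t" using \<open>s - t = n\<close> by simp
qed

context
  fixes p x
  assumes x: "x \<in> standard_simplex p - simplex_bd p"
begin

lemma psum_strict_mono: "strict_mono_on {..Suc p} (psum x)"
proof (rule strict_mono_onI)
  fix i j assume "i < j" "j \<in> {..Suc p}"
  then show "psum x i < psum x j"
  proof (induction j)
    case (Suc j)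
    then have "0 < x j" using x by (force simp: simplex_bd_def standard_simplex_def order_less_le)
    moreover have "psum x i \<le> psum x j" using Suc by (cases "i = j") auto
    ultimately show ?case by (simp add: psum_Suc)
  qed simp
qed

lemma psum_in_unit: "i \<le> p \<Longrightarrow> psum x i \<in> {0..<1}"
  using strict_mono_onD [OF psum_strict_mono, of 0 i] strict_mono_onD [OF psum_strict_mono, of i "Suc p"]
    psum_simplex [of x p] x by (cases "i = 0") auto

lemma inj_on_circle_point: "inj_on (circle_point x) {..p}"
proof
  fix i j assume ij: "i \<in> {..p}" "j \<in> {..p}" and "circle_point x i = circle_point x j"
  then have "psum x i = psum x j"
    using inj_onD [OF inj_on_cis_unit, of "psum x i" "psum x j"] psum_in_unit by (auto simp: circle_point_def)
  then show "i = j"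
    using strict_mono_on_imp_inj_on [OF psum_strict_mono] ij by (auto dest: inj_onD)
qed

end

lemma strict_mono_on_image_eq:
  fixes f g :: "nat \<Rightarrow> real"
  assumes f: "strict_mono_on J f" and g: "strict_mono_on J g" and eq: "f ` J = g ` J" and "i \<in> J"
  shows "f i = g i"
  using \<open>i \<in> J\<close>
proof (induction i rule: less_induct)
  case (less i)
  have *: "h' i \<le> h i" 
    if h: "strict_mono_on J h" "strict_mono_on J h'" "h ` J = h' ` J" "\<And>j. j < i \<Longrightarrow> j \<in> J \<Longrightarrow> h j = h' j" 
    for h h' :: "nat \<Rightarrow> real"
  proof -
    obtain j where j: "j \<in> J" "h i = h' j" using h(3) less.prems by auto
    have "\<not> j < i" using strict_mono_onD [OF h(1) j(1) less.prems] h(4) j by fastforce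
    then show ?thesis
      using strict_mono_onD [OF h(2) less.prems j(1)] j by (cases "i = j") auto
  qed
  show ?case
    using *[OF f g eq less.IH] *[OF g f eq [symmetric] less.IH [symmetric]] by auto
qed

lemma simplex_eqI:
  assumes x: "x \<in> standard_simplex p" and y: "y \<in> standard_simplex p"
    and eq: "\<And>i. i \<in> {1..p} \<Longrightarrow> psum x i = psum y i"
  shows "x = y"
proof
  fix i
  have eq': "psum x i = psum y i" if "i \<le> Suc p" for i
    using that eq [of i] psum_simplex x y by (cases "i = 0"; cases "i = Suc p") auto
  show "x i = y i"
  proof (cases "i \<le> p")
    case True
    then show ?thesis using eq' [of i] eq' [of "Suc i"] by (simp add: psum_Suc)
  qed (use x y in \<open>auto simp: standard_simplex_def\<close>)
qed

lemma circle_point_image_inj: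
  assumes x: "x \<in> standard_simplex p - simplex_bd p" and y: "y \<in> standard_simplex p - simplex_bd p"
    and J: "{1..p} \<subseteq> J" "J \<subseteq> {..p}" and eq: "circle_point x ` J = circle_point y ` J"
  shows "x = y"
proof -
  let ?c = "\<lambda>t. cis (2 * pi * t)"
  have c: "?c ` (psum x ` J) = ?c ` (psum y ` J)"
    using eq by (simp add: circle_point_def image_image)
  have u: "psum x ` J \<subseteq> {0..<1}" "psum y ` J \<subseteq> {0..<1}"
    using J psum_in_unit [OF x] psum_in_unit [OF y] by auto
  have im: "psum x ` J = psum y ` J"
    using inj_on_image_eq_iff [OF inj_on_cis_unit u] c by simp
  have J': "J \<subseteq> {..Suc p}" using J by auto
  have sm: "strict_mono_on J (psum x)" "strict_mono_on J (psum y)"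
    using psum_strict_mono [OF x] psum_strict_mono [OF y] J' by (auto simp: strict_mono_on_def subset_iff)
  show ?thesis
    using strict_mono_on_image_eq [OF sm im] x y J by (intro simplex_eqI [of x p]) auto
qed

section \<open>The topology of the space of finite subsets\<close>

abbreviation circle_power :: "nat \<Rightarrow> (nat \<Rightarrow> complex) topology" where
  "circle_power n \<equiv> product_topology (\<lambda>i. circle) {..<n}"

lemma topspace_circle: "topspace circle = sphere 0 1"
  by (simp add: circle_def)

lemma openin_quotient_topology:
  "openin (quotient_topology X f) U \<longleftrightarrow> U \<subseteq> f ` topspace X \<and> openin X {x \<in> topspace X. f x \<in> U}"
  unfolding quotient_topology_def by (simp add: topology_inverse' [OF istopology_quotient])

lemma topspace_quotient_topology: "topspace (quotient_topology X f) = f ` topspace X"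
proof
  show "topspace (quotient_topology X f) \<subseteq> f ` topspace X"
    using openin_quotient_topology by (metis openin_topspace)
  have "{x \<in> topspace X. f x \<in> f ` topspace X} = topspace X" by auto
  then show "f ` topspace X \<subseteq> topspace (quotient_topology X f)"
    by (intro openin_subset) (simp add: openin_quotient_topology)
qed

lemma quotient_map_quotient_topology: "quotient_map X (quotient_topology X f) f"
  by (simp add: quotient_map_def topspace_quotient_topology openin_quotient_topology)

lemma quotient_map_finite_subset_space:
  "quotient_map (circle_power n) (finite_subset_space n) (\<lambda>z. z ` {..<n})"
  unfolding finite_subset_space_def by (rule quotient_map_quotient_topology)

lemma topspace_finite_subset_space:
  "topspace (finite_subset_space n) = (\<lambda>z. z ` {..<n}) ` ({..<n} \<rightarrow>\<^sub>E sphere 0 1)"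
  unfolding finite_subset_space_def by (simp add: topspace_quotient_topology topspace_circle)

lemma continuous_map_dist_finite_subset_space:
  assumes "n > 0"
  shows "continuous_map (finite_subset_space n) euclideanreal (\<lambda>S. Min (dist w ` S))"
proof (rule continuous_compose_quotient_map [OF quotient_map_finite_subset_space])
  have eq: "{..<n} = {..n - 1}" using assms by auto
  have "continuous_map (circle_power n) euclideanreal (\<lambda>z. dist w (z i))" if "i < n" for i
  proof -
    have "continuous_map (circle_power n) euclidean (\<lambda>z. z i)"
      using continuous_map_product_projection [of i "{..<n}" "\<lambda>i. circle"] that
      by (auto simp: circle_def continuous_map_in_subtopology)
    moreover have "continuous_map euclidean euclideanreal (\<lambda>z::complex. dist w z)"
      by (simp add: continuous_intros)
    ultimately show ?thesis
      using continuous_map_compose [of _ _ "\<lambda>z. z i" _ "dist w"] by (simp add: o_def)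
  qed
  then have "continuous_map (circle_power n) euclideanreal (\<lambda>z. min_coord (n - 1) (\<lambda>i. dist w (z i)))"
    using assms by (intro continuous_map_min_coord) auto
  then show "continuous_map (circle_power n) euclideanreal ((\<lambda>S. Min (dist w ` S)) \<circ> (\<lambda>z. z ` {..<n}))"
    by (simp add: min_coord_def o_def image_image eq)
qed

text \<open>Distinct finite sets are separated by the distance to a point of their symmetric difference.\<close>

lemma Hausdorff_finite_subset_space:
  assumes "n > 0"
  shows "Hausdorff_space (finite_subset_space n)"
  unfolding Hausdorff_space_def
proof (intro allI impI, elim conjE)
  fix S T assume ST: "S \<in> topspace (finite_subset_space n)" "T \<in> topspace (finite_subset_space n)" "S \<noteq> T"
  then have fin: "finite S" "S \<noteq> {}" "finite T" "T \<noteq> {}"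
    using assms by (auto simp: topspace_finite_subset_space)
  have zero_iff: "Min (dist w ` R) = 0 \<longleftrightarrow> w \<in> R" if "finite R" "R \<noteq> {}" for w :: complex and R
  proof
    assume "Min (dist w ` R) = 0"
    then show "w \<in> R" using Min_in [of "dist w ` R"] that by auto
  next
    assume "w \<in> R"
    then have "Min (dist w ` R) \<le> dist w w" using that by (intro Min_le) auto
    moreover have "Min (dist w ` R) \<ge> 0" using that by auto
    ultimately show "Min (dist w ` R) = 0" by simp
  qed
  obtain w where "w \<in> S - T \<or> w \<in> T - S" using ST by blast
  then have "Min (dist w ` S) \<noteq> Min (dist w ` T)"
    using zero_iff fin by (metis Diff_iff)
  then obtain U V where UV: "open U" "open V" "Min (dist w ` S) \<in> U" "Min (dist w ` T) \<in> V" "U \<inter> V = {}"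
    using hausdorff by metis
  let ?g = "\<lambda>R. Min (dist w ` R)" and ?X = "finite_subset_space n"
  have "openin ?X {R \<in> topspace ?X. ?g R \<in> U}" "openin ?X {R \<in> topspace ?X. ?g R \<in> V}"
    using openin_continuous_map_preimage [OF continuous_map_dist_finite_subset_space [OF assms, of w]] UV by auto
  moreover have "disjnt {R \<in> topspace ?X. ?g R \<in> U} {R \<in> topspace ?X. ?g R \<in> V}"
    using UV by (auto simp: disjnt_def)
  ultimately show "\<exists>U V. openin ?X U \<and> openin ?X V \<and> S \<in> U \<and> T \<in> V \<and> disjnt U V"
    using ST UV by blast
qed

lemma continuous_map_circle_point:
  "continuous_map (simplex_space p) circle (\<lambda>x. circle_point x i)"
proof -
  have "continuous_map (simplex_space p) euclideanreal (\<lambda>x. psum x i)"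
    unfolding psum_def
    by (intro continuous_map_sum continuous_map_from_subtopology continuous_map_coord) auto
  moreover have "continuous_map euclideanreal euclidean (\<lambda>t. cis (2 * pi * t))"
    by (simp add: continuous_intros)
  ultimately have "continuous_map (simplex_space p) euclidean (\<lambda>x. circle_point x i)"
    unfolding circle_point_def using continuous_map_compose [of _ _ "\<lambda>x. psum x i" _ "\<lambda>t. cis (2 * pi * t)"]
    by (simp add: o_def)
  then show ?thesis
    by (auto simp: circle_def continuous_map_in_subtopology circle_point_def)
qed

lemma continuous_map_circle_points:
  assumes "finite J" "J \<noteq> {}" "card J \<le> n"
  shows "continuous_map (simplex_space p) (finite_subset_space n) (\<lambda>x. circle_point x ` J)"
proof -
  obtain g where g: "g ` {..<n} = J"
  proof -
    obtain h where h: "bij_betw h {0..<card J} J" using ex_bij_betw_nat_finite [OF assms(1)] by blast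
    have c: "0 < card J" using assms by (simp add: card_gt_0_iff)
    have "(\<lambda>i. h (if i < card J then i else 0)) ` {..<n} = h ` {0..<card J}"
      using assms(3) c by (force simp: image_iff)
    then show thesis using that h by (simp add: bij_betw_def)
  qed
  have "continuous_map (simplex_space p) (circle_power n) (\<lambda>x. \<lambda>i\<in>{..<n}. circle_point x (g i))"
    unfolding continuous_map_componentwise
  proof (intro conjI ballI)
    fix k assume "k \<in> {..<n}"
    then show "continuous_map (simplex_space p) circle (\<lambda>x. (\<lambda>i\<in>{..<n}. circle_point x (g i)) k)"
      using continuous_map_circle_point by simp
  qed auto
  then have "continuous_map (simplex_space p) (finite_subset_space n) ((\<lambda>z. z ` {..<n}) \<circ> (\<lambda>x. \<lambda>i\<in>{..<n}. circle_point x (g i)))"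
    by (rule continuous_map_compose) (rule quotient_imp_continuous_map [OF quotient_map_finite_subset_space])
  moreover have "(\<lambda>i\<in>{..<n}. circle_point x (g i)) ` {..<n} = circle_point x ` J" for x
    using g by force
  ultimately show ?thesis by (simp add: o_def)
qed

lemma sphere_cis_unit:
  assumes "norm z = 1" obtains t where "t \<in> {0..<1}" "z = cis (2 * pi * t)"
proof -
  obtain r where r: "0 \<le> r" "r < 2 * pi" "z = exp (\<i> * of_real r)"
    using complex_unimodular_polar [OF assms] by (metis cis_conv_exp complex_eq_iff cis.simps complex.sel)
  show thesis
    by (rule that [of "r / (2 * pi)"]) (use r in \<open>auto simp: cis_conv_exp field_simps\<close>)
qed

lemma finite_subset_eq_circle_points:
  assumes S: "S \<in> topspace (finite_subset_space n)" and "n > 0"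
  obtains x where "x \<in> standard_simplex n" "S = circle_point x ` {1..n}"
proof -
  obtain z where z: "z \<in> {..<n} \<rightarrow>\<^sub>E sphere 0 1" "S = z ` {..<n}"
    using S by (auto simp: topspace_finite_subset_space)
  have "\<exists>t. t \<in> {0..<1} \<and> z i = cis (2 * pi * t)" if "i < n" for i
  proof -
    have "norm (z i) = 1" using z that by (auto simp: PiE_iff)
    then show ?thesis by (rule sphere_cis_unit) blast
  qed
  then obtain t where t: "\<And>i. i < n \<Longrightarrow> t i \<in> {0..<1} \<and> z i = cis (2 * pi * t i)" by metis
  define ts where "ts = sort (map t [0..<n])"
  have len: "length ts = n" by (simp add: ts_def)
  have set: "set ts = t ` {..<n}" by (auto simp: ts_def)
  have range: "ts ! i \<in> {0..<1}" if "i < n" for i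
    using nth_mem [of i ts] that len set t by auto
  have sorted: "ts ! i \<le> ts ! j" if "i \<le> j" "j < n" for i j
    using sorted_nth_mono [of ts i j] that len by (simp add: ts_def)
  define x where "x i = (if i = 0 then ts ! 0 else if i < n then ts ! i - ts ! (i - 1)
      else if i = n then 1 - ts ! (n - 1) else 0)" for i
  have ps: "psum x (Suc i) = ts ! i" if "i < n" for i
    using that by (induction i) (auto simp: psum_Suc x_def)
  have "psum x (Suc n) = 1"
    using ps [of "n - 1"] \<open>n > 0\<close> by (simp add: psum_Suc x_def)
  then have "(\<Sum>i\<le>n. x i) = 1" by (simp add: psum_def lessThan_Suc_atMost)
  moreover have "0 \<le> x i" for i
    using range [of 0] range [of "n - 1"] sorted [of "i - 1" i] \<open>n > 0\<close> by (auto simp: x_def)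
  ultimately have "x \<in> standard_simplex n"
    by (intro standard_simplexI) (auto simp: x_def)
  moreover have "S = circle_point x ` {1..n}"
  proof -
    have "{1..n} = Suc ` {..<n}" by (auto simp: image_iff Bex_def gr0_conv_Suc Suc_le_eq)
    then have "circle_point x ` {1..n} = (\<lambda>i. cis (2 * pi * (ts ! i))) ` {..<n}"
      by (auto simp: image_image circle_point_def ps)
    also have "\<dots> = (\<lambda>t. cis (2 * pi * t)) ` set ts"
      by (auto simp: set_conv_nth len image_iff)
    also have "\<dots> = z ` {..<n}" using t by (auto simp: set image_image)
    finally show ?thesis using z by simp
  qed
  ultimately show thesis using that by blast
qed

section \<open>The cells of the space of finite subsets\<close>

definition based_cell :: "nat \<Rightarrow> (nat \<Rightarrow> real) \<Rightarrow> complex set" where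
  "based_cell p x = circle_point x ` {..p}"

definition free_cell :: "nat \<Rightarrow> (nat \<Rightarrow> real) \<Rightarrow> complex set" where
  "free_cell p x = circle_point x ` {1..p}"

lemma based_cell_face:
  assumes "y \<in> standard_simplex p" "k \<le> Suc p"
  shows "based_cell (Suc p) (simplical_face k y) = based_cell p y"
proof -
  have "(\<lambda>i. circle_point y (if i \<le> k then i else i - 1)) ` {..Suc p} = circle_point y ` {..p}"
  proof (intro equalityI subsetI)
    fix z assume "z \<in> (\<lambda>i. circle_point y (if i \<le> k then i else i - 1)) ` {..Suc p}"
    then obtain i where i: "i \<le> Suc p" "z = circle_point y (if i \<le> k then i else i - 1)" by auto
    show "z \<in> circle_point y ` {..p}"
    proof (cases "i \<le> k \<and> i = Suc p")
      case True
      then have "z = circle_point y 0" using i circle_point_last [OF assms(1)] by simp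
      then show ?thesis by blast
    next
      case False
      then show ?thesis using i assms(2) by (auto intro!: image_eqI [where x = "if i \<le> k then i else i - 1"])
    qed
  next
    fix z assume "z \<in> circle_point y ` {..p}"
    then obtain i where i: "i \<le> p" "z = circle_point y i" by auto
    then show "z \<in> (\<lambda>i. circle_point y (if i \<le> k then i else i - 1)) ` {..Suc p}"
      by (auto intro!: image_eqI [where x = "if i \<le> k then i else Suc i"])
  qed
  then show ?thesis by (simp add: based_cell_def circle_point_face)
qed

lemma free_cell_face:
  assumes "y \<in> standard_simplex p" "k \<le> Suc p"
  shows "free_cell (Suc p) (simplical_face k y) = (if k = 0 \<or> k = Suc p then based_cell p y else free_cell p y)"
proof -
  consider "k = 0" | "k = Suc p" | "1 \<le> k" "k \<le> p" using assms(2) by linarith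
  then show ?thesis
  proof cases
    case 1
    have "{..p} = (\<lambda>i. i - 1) ` {1..Suc p}" by (force simp: image_iff intro: bexI [where x = "Suc _"])
    then show ?thesis using 1 by (auto simp: free_cell_def based_cell_def circle_point_face image_image)
  next
    case 2
    have "free_cell (Suc p) (simplical_face k y) = circle_point y ` {1..Suc p}"
      using 2 by (simp add: free_cell_def circle_point_face cong: image_cong_simp)
    also have "{1..Suc p} = insert (Suc p) {1..p}" by auto
    also have "circle_point y ` \<dots> = circle_point y ` insert 0 {1..p}"
      using circle_point_last [OF assms(1)] by simp
    also have "insert 0 {1..p} = {..p}" by auto
    finally show ?thesis using 2 by (simp add: based_cell_def)
  next
    case 3
    have "(\<lambda>i. if i \<le> k then i else i - 1) ` {1..Suc p} = {1..p}"
    proof (intro equalityI subsetI)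
      fix i assume "i \<in> {1..p}"
      then show "i \<in> (\<lambda>i. if i \<le> k then i else i - 1) ` {1..Suc p}"
        by (auto intro!: image_eqI [where x = "if i \<le> k then i else Suc i"])
    qed (use 3 in \<open>auto split: if_splits\<close>)
    moreover have "free_cell (Suc p) (simplical_face k y) = circle_point y ` (\<lambda>i. if i \<le> k then i else i - 1) ` {1..Suc p}"
      unfolding free_cell_def circle_point_face image_image ..
    ultimately show ?thesis using 3 by (simp only: free_cell_def) auto
  qed
qed

lemma singular_face_cell_simplex:
  assumes "k \<le> Suc p" and "\<And>y. y \<in> standard_simplex p \<Longrightarrow> \<sigma> (simplical_face k y) = \<tau> y"
  shows "singular_face (Suc p) k (cell_simplex (Suc p) \<sigma>) = cell_simplex p \<tau>"
  using assms simplical_face_in_standard_simplex [of "Suc p" k]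
  by (auto simp: singular_face_def cell_simplex_def fun_eq_iff restrict_def)

lemma alternating_sum_even: "(\<Sum>k\<le>2 * m. frag_cmul ((-1) ^ k) c) = c"
  by (induction m) auto

lemma chain_boundary_based_cell:
  assumes "even p"
  shows "chain_boundary (Suc (Suc p)) (frag_of (cell_simplex (Suc (Suc p)) (based_cell (Suc (Suc p)))))
     = frag_of (cell_simplex (Suc p) (based_cell (Suc p)))"
proof -
  obtain m where m: "Suc (Suc p) = 2 * m" using assms by (metis dvd_def even_Suc)
  have face: "singular_face (Suc (Suc p)) k (cell_simplex (Suc (Suc p)) (based_cell (Suc (Suc p))))
     = cell_simplex (Suc p) (based_cell (Suc p))" if "k \<le> Suc (Suc p)" for k
    using that by (intro singular_face_cell_simplex based_cell_face)
  have "chain_boundary (Suc (Suc p)) (frag_of (cell_simplex (Suc (Suc p)) (based_cell (Suc (Suc p)))))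
     = (\<Sum>k\<le>Suc (Suc p). frag_cmul ((-1) ^ k) (frag_of (cell_simplex (Suc p) (based_cell (Suc p)))))"
    unfolding chain_boundary_of by (simp only: if_False nat.simps) (intro sum.cong refl, simp add: face)
  then show ?thesis unfolding m by (simp only: alternating_sum_even)
qed

lemma chain_boundary_free_cell:
  assumes "even p"
  shows "chain_boundary (Suc (Suc p)) (frag_of (cell_simplex (Suc (Suc p)) (free_cell (Suc (Suc p)))))
      - frag_cmul (-1) (frag_of (cell_simplex (Suc p) (free_cell (Suc p))))
     = frag_of (cell_simplex (Suc p) (based_cell (Suc p))) + frag_of (cell_simplex (Suc p) (based_cell (Suc p)))"
proof -
  obtain m where m: "Suc (Suc p) = 2 * m" using assms by (metis dvd_def even_Suc)
  define e where "e = frag_of (cell_simplex (Suc p) (free_cell (Suc p)))"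
  define f where "f = frag_of (cell_simplex (Suc p) (based_cell (Suc p)))"
  have face: "frag_of (singular_face (Suc (Suc p)) k (cell_simplex (Suc (Suc p)) (free_cell (Suc (Suc p)))))
     = (if k = 0 \<or> k = Suc (Suc p) then f else e)" if "k \<le> Suc (Suc p)" for k
  proof -
    have "singular_face (Suc (Suc p)) k (cell_simplex (Suc (Suc p)) (free_cell (Suc (Suc p))))
      = cell_simplex (Suc p) (if k = 0 \<or> k = Suc (Suc p) then based_cell (Suc p) else free_cell (Suc p))"
      using that by (intro singular_face_cell_simplex) (simp_all add: free_cell_face)
    then show ?thesis by (simp add: e_def f_def)
  qed
  have "chain_boundary (Suc (Suc p)) (frag_of (cell_simplex (Suc (Suc p)) (free_cell (Suc (Suc p)))))
     = (\<Sum>k\<le>Suc (Suc p). frag_cmul ((-1) ^ k) (if k = 0 \<or> k = Suc (Suc p) then f else e))"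
    unfolding chain_boundary_of by (simp only: if_False nat.simps) (intro sum.cong refl, simp add: face)
  also have "\<dots> = (\<Sum>k\<le>Suc (Suc p). frag_cmul ((-1) ^ k) e + ((if k = 0 then f - e else 0) + (if k = Suc (Suc p) then f - e else 0)))"
    using assms by (intro sum.cong) auto
  also have "\<dots> = e + ((f - e) + (f - e))"
    unfolding sum.distrib m alternating_sum_even using m by simp
  finally show ?thesis by (simp add: e_def f_def)
qed

lemma closedin_circle_points:
  assumes "finite J" "J \<noteq> {}" "card J \<le> n"
  shows "closedin (finite_subset_space n) ((\<lambda>x. circle_point x ` J) ` standard_simplex p)"
proof (rule compactin_imp_closedin)
  have "card J > 0" using assms by (simp add: card_gt_0_iff)
  then show "Hausdorff_space (finite_subset_space n)"
    using assms(3) by (intro Hausdorff_finite_subset_space) simp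
  show "compactin (finite_subset_space n) ((\<lambda>x. circle_point x ` J) ` standard_simplex p)"
    by (rule image_compactin [OF _ continuous_map_circle_points [OF assms, of p]])
       (simp add: compactin_subtopology compactin_standard_simplex)
qed

lemma cell_attachment_circle_points:
  assumes J: "{1..p} \<subseteq> J" "J \<subseteq> {..p}" "J \<noteq> {}" "card J \<le> n"
    and W: "closedin (finite_subset_space n) W"
    and bd: "\<And>x. x \<in> simplex_bd p \<Longrightarrow> circle_point x ` J \<in> W"
    and disj: "\<And>x. x \<in> standard_simplex p - simplex_bd p \<Longrightarrow> circle_point x ` J \<notin> W"
  shows "cell_attachment p (subtopology (finite_subset_space n) (W \<union> (\<lambda>x. circle_point x ` J) ` standard_simplex p))
     W (\<lambda>x. circle_point x ` J)"
proof
  let ?X = "finite_subset_space n" and ?\<sigma> = "\<lambda>x. circle_point x ` J"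
  let ?V = "W \<union> ?\<sigma> ` standard_simplex p"
  have fin: "finite J" using J(2) finite_subset by blast
  then have "card J > 0" using J by (simp add: card_gt_0_iff)
  then show "Hausdorff_space (subtopology ?X ?V)"
    using J(4) by (intro Hausdorff_space_subtopology Hausdorff_finite_subset_space) simp
  show "closedin (subtopology ?X ?V) W"
    using W by (intro closedin_subset_topspace) auto
  have c: "continuous_map (simplex_space p) ?X ?\<sigma>"
    by (rule continuous_map_circle_points [OF fin J(3,4)])
  then show "continuous_map (simplex_space p) (subtopology ?X ?V) ?\<sigma>"
    by (auto simp: continuous_map_in_subtopology)
  show "?\<sigma> ` simplex_bd p \<subseteq> W" using bd by auto
  show "inj_on ?\<sigma> (standard_simplex p - simplex_bd p)"
    using circle_point_image_inj [OF _ _ J(1,2)] by (auto intro: inj_onI)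
  show "?\<sigma> ` (standard_simplex p - simplex_bd p) \<inter> W = {}" using disj by auto
  show "topspace (subtopology ?X ?V) = ?V"
    using closedin_subset [OF W] continuous_map_image_subset_topspace [OF c] by auto
qed

definition based_part :: "nat \<Rightarrow> complex set set" where
  "based_part p = based_cell p ` standard_simplex p"

definition free_part :: "nat \<Rightarrow> nat \<Rightarrow> complex set set" where
  "free_part n j = based_part (n - 1) \<union> (\<Union>i\<in>{1..j}. free_cell i ` standard_simplex i)"

lemma closedin_based_part: "p < n \<Longrightarrow> closedin (finite_subset_space n) (based_part p)"
  unfolding based_part_def based_cell_def by (intro closedin_circle_points) auto

lemma based_cell_in_part: "y \<in> standard_simplex p \<Longrightarrow> based_cell p y \<in> based_part p"
  by (simp add: based_part_def)

lemma based_part_Suc: "based_part p \<subseteq> based_part (Suc p)"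
proof
  fix S assume "S \<in> based_part p"
  then obtain y where "y \<in> standard_simplex p" "S = based_cell p y" by (auto simp: based_part_def)
  then have "S = based_cell (Suc p) (simplical_face 0 y)" "simplical_face 0 y \<in> standard_simplex (Suc p)"
    using simplical_face_in_standard_simplex [of "Suc p" 0 y] by (simp_all add: based_cell_face)
  then show "S \<in> based_part (Suc p)" by (simp add: based_part_def)
qed

lemma based_part_mono: "p \<le> q \<Longrightarrow> based_part p \<subseteq> based_part q"
  using based_part_Suc by (rule lift_Suc_mono_le)

lemma closedin_free_part:
  assumes "0 < n" "j \<le> n"
  shows "closedin (finite_subset_space n) (free_part n j)"
proof -
  have "closedin (finite_subset_space n) (free_cell i ` standard_simplex i)" if "i \<in> {1..j}" for i
    unfolding free_cell_def using that assms by (intro closedin_circle_points) auto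
  then show ?thesis
    unfolding free_part_def using assms by (intro closedin_Un closedin_based_part closedin_Union) auto
qed

lemma cell_attachment_based:
  assumes "Suc p < n"
  shows "cell_attachment (Suc p) (subtopology (finite_subset_space n) (based_part (Suc p))) (based_part p) (based_cell (Suc p))"
proof -
  have eq: "based_part (Suc p) = based_part p \<union> (\<lambda>x. circle_point x ` {..Suc p}) ` standard_simplex (Suc p)"
    using based_part_Suc [of p] by (auto simp: based_part_def based_cell_def)
  have eq': "based_cell (Suc p) = (\<lambda>x. circle_point x ` {..Suc p})"
    by (auto simp: based_cell_def)
  show ?thesis
    unfolding eq unfolding eq'
  proof (rule cell_attachment_circle_points)
    show "closedin (finite_subset_space n) (based_part p)"
      using assms by (intro closedin_based_part) simp
    fix x
    show "circle_point x ` {..Suc p} \<in> based_part p" if bdx: "x \<in> simplex_bd (Suc p)"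
    proof -
      obtain k y where k: "k \<le> Suc p" and y: "y \<in> standard_simplex p" and x: "x = simplical_face k y"
        by (rule bd_eq_face [OF bdx])
      have "circle_point x ` {..Suc p} = based_cell p y"
        using based_cell_face [OF y k] by (simp add: x based_cell_def)
      then show ?thesis using y by (simp add: based_cell_in_part)
    qed
    show "circle_point x ` {..Suc p} \<notin> based_part p" if "x \<in> standard_simplex (Suc p) - simplex_bd (Suc p)"
    proof
      assume "circle_point x ` {..Suc p} \<in> based_part p"
      then obtain y where "circle_point x ` {..Suc p} = circle_point y ` {..p}"
        by (auto simp: based_part_def based_cell_def)
      moreover have "card (circle_point x ` {..Suc p}) = Suc (Suc p)"
        using card_image [OF inj_on_circle_point [OF that]] by simp
      ultimately show False using card_image_le [of "{..p}" "circle_point y"] by simp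
    qed
  qed (use assms in auto)
qed

lemma cell_attachment_free:
  assumes "p < n"
  shows "cell_attachment (Suc p) (subtopology (finite_subset_space n) (free_part n (Suc p))) (free_part n p) (free_cell (Suc p))"
proof -
  have eq: "free_part n (Suc p) = free_part n p \<union> (\<lambda>x. circle_point x ` {1..Suc p}) ` standard_simplex (Suc p)"
    by (auto simp: free_part_def free_cell_def atLeastAtMostSuc_conv)
  have eq': "free_cell (Suc p) = (\<lambda>x. circle_point x ` {1..Suc p})"
    by (auto simp: free_cell_def)
  show ?thesis
    unfolding eq unfolding eq'
  proof (rule cell_attachment_circle_points)
    show "closedin (finite_subset_space n) (free_part n p)"
      using assms by (intro closedin_free_part) simp_all
    fix x
    show "circle_point x ` {1..Suc p} \<in> free_part n p" if bdx: "x \<in> simplex_bd (Suc p)"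
    proof -
      obtain k y where k: "k \<le> Suc p" and y: "y \<in> standard_simplex p" and x: "x = simplical_face k y"
        by (rule bd_eq_face [OF bdx])
      have cp: "circle_point x ` {1..Suc p} = (if k = 0 \<or> k = Suc p then based_cell p y else free_cell p y)"
        using free_cell_face [OF y k] by (simp add: x free_cell_def)
      have "based_cell p y \<in> based_part (n - 1)"
        by (rule subsetD [OF based_part_mono based_cell_in_part [OF y]]) (use assms in simp)
      moreover have "free_cell p y \<in> free_part n p" if "1 \<le> p"
        using y that by (auto simp: free_part_def)
      ultimately show ?thesis
        using k unfolding cp by (auto simp: free_part_def)
    qed
    show "circle_point x ` {1..Suc p} \<notin> free_part n p" if x: "x \<in> standard_simplex (Suc p) - simplex_bd (Suc p)"
    proof
      note inj = inj_on_circle_point [OF x]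
      assume "circle_point x ` {1..Suc p} \<in> free_part n p"
      then consider "circle_point x ` {1..Suc p} \<in> based_part (n - 1)"
        | i y where "i \<le> p" "circle_point x ` {1..Suc p} = circle_point y ` {1..i}"
        by (auto simp: free_part_def free_cell_def)
      then show False
      proof cases
        case 1
        then obtain y where "circle_point x ` {1..Suc p} = circle_point y ` {..n - 1}"
          by (auto simp: based_part_def based_cell_def)
        moreover have "1 \<in> circle_point y ` {..n - 1}" by (rule image_eqI [where x = 0]) simp_all
        ultimately have "1 \<in> circle_point x ` {1..Suc p}" by simp
        then obtain i where "1 = circle_point x i" "i \<in> {1..Suc p}" by (rule imageE)
        then show False using inj_onD [OF inj, of i 0] by simp
      next
        case 2
        have "card (circle_point x ` {1..Suc p}) = Suc p"
          using card_image [OF inj_on_subset [OF inj, of "{1..Suc p}"]] by auto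
        then show False using 2 card_image_le [of "{1..i}" "circle_point y"] by simp
      qed
    qed
  qed (use assms in auto)
qed

lemma singular_simplex_based_cell:
  assumes "p < n" "based_part p \<subseteq> V"
  shows "singular_simplex p (subtopology (finite_subset_space n) V) (cell_simplex p (based_cell p))"
proof -
  have "continuous_map (simplex_space p) (finite_subset_space n) (\<lambda>x. circle_point x ` {..p})"
    using assms by (intro continuous_map_circle_points) auto
  then have "continuous_map (simplex_space p) (finite_subset_space n) (based_cell p)"
    by (simp add: based_cell_def [abs_def])
  then have "continuous_map (simplex_space p) (finite_subset_space n) (cell_simplex p (based_cell p))"
    by (rule continuous_map_eq) (simp add: cell_simplex_def)
  then have "singular_simplex p (finite_subset_space n) (cell_simplex p (based_cell p))"
    by (simp add: singular_simplex_def) (simp add: cell_simplex_def)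
  moreover have "cell_simplex p (based_cell p) ` standard_simplex p \<subseteq> V"
    using assms(2) by (simp add: cell_simplex_def based_part_def)
  ultimately show ?thesis by (simp add: singular_simplex_subtopology)
qed

lemma free_part_full:
  assumes "0 < n"
  shows "free_part n n = topspace (finite_subset_space n)"
proof
  show "free_part n n \<subseteq> topspace (finite_subset_space n)"
    using closedin_subset [OF closedin_free_part [OF assms order_refl]] .
  show "topspace (finite_subset_space n) \<subseteq> free_part n n"
  proof
    fix S assume "S \<in> topspace (finite_subset_space n)"
    then obtain x where "x \<in> standard_simplex n" "S = circle_point x ` {1..n}"
      using finite_subset_eq_circle_points assms by metis
    then have "S \<in> free_cell n ` standard_simplex n" by (auto simp: free_cell_def)
    moreover have "n \<in> {1..n}" using assms by simp
    ultimately show "S \<in> free_part n n" unfolding free_part_def by blast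
  qed
qed

lemma path_connected_finite_subset_space:
  assumes "0 < n" shows "path_connected_space (finite_subset_space n)"
proof -
  let ?f = "\<lambda>x. circle_point x ` {1..n}"
  have c: "continuous_map (simplex_space n) (finite_subset_space n) ?f"
    using assms by (intro continuous_map_circle_points) auto
  have "path_connectedin (simplex_space n) (standard_simplex n)"
    by (simp add: path_connectedin_subtopology path_connectedin_standard_simplex)
  then have "path_connectedin (finite_subset_space n) (?f ` standard_simplex n)"
    by (rule path_connectedin_continuous_map_image [OF c])
  moreover have "topspace (finite_subset_space n) = ?f ` standard_simplex n"
  proof
    show "topspace (finite_subset_space n) \<subseteq> ?f ` standard_simplex n"
      by (rule subsetI, erule finite_subset_eq_circle_points [OF _ assms]) blast
  qed (use continuous_map_image_subset_topspace [OF c] in simp)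
  ultimately show ?thesis by (simp add: path_connectedin_topspace [symmetric])
qed

lemma homology_based_part:
  assumes "p < n"
  shows "even p \<Longrightarrow> trivial_group (relative_homology_group k (subtopology (finite_subset_space n) (based_part p)) (based_part 0))"
    and "odd p \<Longrightarrow> k \<noteq> int p \<Longrightarrow> trivial_group (relative_homology_group k (subtopology (finite_subset_space n) (based_part p)) (based_part 0))"
    and "odd p \<Longrightarrow> relative_homology_group p (subtopology (finite_subset_space n) (based_part p)) (based_part 0) \<cong> integer_group"
proof -
  have att: "cell_attachment (Suc j) (subtopology (finite_subset_space n) (based_part (Suc j))) (based_part j) (based_cell (Suc j))"
    if "j < p" for j
    using that assms by (intro cell_attachment_based) simp
  have bdry: "singular_chain (Suc j) (subtopology (finite_subset_space n) (based_part j))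
      (chain_boundary (Suc (Suc j)) (frag_of (cell_simplex (Suc (Suc j)) (based_cell (Suc (Suc j)))))
        - frag_cmul 1 (frag_of (cell_simplex (Suc j) (based_cell (Suc j)))))" if "even j" "Suc j < p" for j
    using that by (simp add: chain_boundary_based_cell)
  have V0: "based_part 0 \<subseteq> topspace (finite_subset_space n)"
    using assms closedin_subset [OF closedin_based_part [of 0 n]] by simp
  note * = homology_cell_filtration [where N = p and X = "finite_subset_space n" and V = based_part and \<sigma> = based_cell, OF att _ bdry V0 order_refl]
  show "even p \<Longrightarrow> trivial_group (relative_homology_group k (subtopology (finite_subset_space n) (based_part p)) (based_part 0))"
    by (rule *(1)) auto
  show "odd p \<Longrightarrow> k \<noteq> int p \<Longrightarrow> trivial_group (relative_homology_group k (subtopology (finite_subset_space n) (based_part p)) (based_part 0))"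
    by (rule *(2)) auto
  show "odd p \<Longrightarrow> relative_homology_group p (subtopology (finite_subset_space n) (based_part p)) (based_part 0) \<cong> integer_group"
    by (rule *(3)) auto
qed

lemma homology_mod_based_part:
  assumes "0 < n"
  shows "even n \<Longrightarrow> trivial_group (relative_homology_group k (finite_subset_space n) (based_part (n - 1)))"
    and "odd n \<Longrightarrow> k \<noteq> int n \<Longrightarrow> trivial_group (relative_homology_group k (finite_subset_space n) (based_part (n - 1)))"
    and "odd n \<Longrightarrow> relative_homology_group n (finite_subset_space n) (based_part (n - 1)) \<cong> integer_group"
proof -
  let ?X = "finite_subset_space n"
  have att: "cell_attachment (Suc j) (subtopology ?X (free_part n (Suc j))) (free_part n j) (free_cell (Suc j))"
    if "j < n" for j
    using that by (rule cell_attachment_free)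
  have bdry: "singular_chain (Suc j) (subtopology ?X (free_part n j))
      (chain_boundary (Suc (Suc j)) (frag_of (cell_simplex (Suc (Suc j)) (free_cell (Suc (Suc j)))))
        - frag_cmul (-1) (frag_of (cell_simplex (Suc j) (free_cell (Suc j)))))" if "even j" "Suc j < n" for j
  proof -
    have "based_part (Suc j) \<subseteq> based_part (n - 1)"
      using that by (intro based_part_mono) simp
    then have "based_part (Suc j) \<subseteq> free_part n j" by (auto simp: free_part_def)
    then show ?thesis
      unfolding chain_boundary_free_cell [OF that(1)]
      using that by (intro singular_chain_add) (simp_all add: singular_chain_of singular_simplex_based_cell)
  qed
  have V0: "free_part n 0 \<subseteq> topspace ?X"
    using closedin_subset [OF closedin_free_part [OF assms]] by simp
  note * = homology_cell_filtration [where N = n and X = ?X and V = "free_part n" and \<sigma> = free_cell, OF att _ bdry V0 order_refl]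
  have eq: "free_part n 0 = based_part (n - 1)" "subtopology ?X (free_part n n) = ?X"
    using assms by (simp_all add: free_part_def [of n 0] free_part_full)
  show "even n \<Longrightarrow> trivial_group (relative_homology_group k ?X (based_part (n - 1)))"
    using *(1) unfolding eq by auto
  show "odd n \<Longrightarrow> k \<noteq> int n \<Longrightarrow> trivial_group (relative_homology_group k ?X (based_part (n - 1)))"
    using *(2) unfolding eq by auto
  show "odd n \<Longrightarrow> relative_homology_group n ?X (based_part (n - 1)) \<cong> integer_group"
    using *(3) unfolding eq by auto
qed

lemma homology_based_part_nonzero:
  assumes n: "3 \<le> n" and "k \<noteq> 0"
  shows "even n \<Longrightarrow> k \<noteq> int n - 1 \<Longrightarrow> trivial_group (homology_group k (subtopology (finite_subset_space n) (based_part (n - 1))))"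
    and "even n \<Longrightarrow> homology_group (int n - 1) (subtopology (finite_subset_space n) (based_part (n - 1))) \<cong> integer_group"
    and "odd n \<Longrightarrow> trivial_group (homology_group k (subtopology (finite_subset_space n) (based_part (n - 1))))"
proof -
  let ?X = "finite_subset_space n" and ?P = "based_part 0"
  let ?Y = "subtopology ?X (based_part (n - 1))"
  have sub: "based_part 0 \<subseteq> based_part (n - 1)" by (rule based_part_mono) simp
  have P: "?P = {{1}}" by (simp add: based_part_def based_cell_def standard_simplex_0)
  have "?P \<subseteq> topspace ?X"
    using closedin_subset [OF closedin_based_part [of 0 n]] n by simp
  then have "topspace (subtopology ?Y ?P) = {{1}}" using P sub by auto
  then have point: "trivial_group (homology_group k (subtopology ?Y ?P))" if "k \<noteq> 0" for k
    using that by (rule homology_dimension_axiom)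
  have lt: "n - 1 < n" and int: "int (n - 1) = int n - 1" using n by auto
  note rel = homology_based_part [OF lt]
  have one: "trivial_group (relative_homology_group 1 ?Y ?P)"
  proof (cases "even n")
    case True
    then have "odd (n - 1)" using n by simp
    then show ?thesis using n by (intro rel(2)) auto
  next
    case False
    then have "even (n - 1)" using n by simp
    then show ?thesis by (rule rel(1))
  qed
  have iso: "hom_induced k ?Y {} ?Y ?P id \<in> iso (homology_group k ?Y) (relative_homology_group k ?Y ?P)" if "k \<noteq> 0" for k
    by (rule iso_hom_induced_acyclic_subspace [OF point one that])
  show "trivial_group (homology_group k ?Y)" if "even n" "k \<noteq> int n - 1"
  proof -
    have "odd (n - 1)" "k \<noteq> int (n - 1)" using that n int by auto
    then have "trivial_group (relative_homology_group k ?Y ?P)" by (rule rel(2))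
    then show ?thesis using trivial_group_iso_iff [OF iso [OF \<open>k \<noteq> 0\<close>]] by simp
  qed
  show "homology_group (int n - 1) ?Y \<cong> integer_group" if "even n"
  proof -
    have "odd (n - 1)" using that n by simp
    then have "relative_homology_group (int (n - 1)) ?Y ?P \<cong> integer_group" by (rule rel(3))
    moreover have "homology_group (int (n - 1)) ?Y \<cong> relative_homology_group (int (n - 1)) ?Y ?P"
      by (rule is_isoI [OF iso]) (use n in simp)
    ultimately show ?thesis unfolding int by (rule iso_trans [rotated])
  qed
  show "trivial_group (homology_group k ?Y)" if "odd n"
  proof -
    have "even (n - 1)" using that n by simp
    then have "trivial_group (relative_homology_group k ?Y ?P)" by (rule rel(1))
    then show ?thesis using trivial_group_iso_iff [OF iso [OF \<open>k \<noteq> 0\<close>]] by simp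
  qed
qed

theorem theorem10p5:
  fixes n :: nat
  assumes "n \<ge> 3"
  shows "(even n \<longrightarrow>
            homology_group 0 (finite_subset_space n) \<cong> integer_group \<and>
            homology_group (int n - 1) (finite_subset_space n) \<cong> integer_group \<and>
            (\<forall>k::int. k \<notin> {0, int n - 1} \<longrightarrow> trivial_group (homology_group k (finite_subset_space n))))
       \<and> (odd n \<longrightarrow>
            homology_group 0 (finite_subset_space n) \<cong> integer_group \<and>
            homology_group (int n) (finite_subset_space n) \<cong> integer_group \<and>
            (\<forall>k::int. k \<notin> {0, int n} \<longrightarrow> trivial_group (homology_group k (finite_subset_space n))))"
proof -
  let ?X = "finite_subset_space n" and ?B = "based_part (n - 1)"
  let ?Y = "subtopology ?X ?B"
  have n: "0 < n" using assms by simp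
  note rel = homology_mod_based_part [OF n]
  note based = homology_based_part_nonzero [OF assms]
  have "topspace ?X \<noteq> {}"
    using n by (auto simp: topspace_finite_subset_space PiE_eq_empty_iff)
  then have zero: "homology_group 0 ?X \<cong> integer_group"
    by (rule isomorphic_integer_zeroth_homology_group [OF path_connected_finite_subset_space [OF n]])
  have "homology_group (int n - 1) ?X \<cong> integer_group \<and>
      (\<forall>k. k \<notin> {0, int n - 1} \<longrightarrow> trivial_group (homology_group k ?X))" if "even n"
  proof -
    have iso: "hom_induced k ?Y {} ?X {} id \<in> iso (homology_group k ?Y) (homology_group k ?X)" for k
    proof (rule very_short_exact_sequence)
      show "exact_seq ([relative_homology_group k ?X ?B, homology_group k ?X, homology_group k ?Y, relative_homology_group (k + 1) ?X ?B],
          [hom_induced k ?X {} ?X ?B id, hom_induced k ?Y {} ?X {} id, hom_boundary (k + 1) ?X ?B])"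
        using homology_exactness_axiom_2 [of "k + 1" ?X ?B] homology_exactness_axiom_3 [of k ?X ?B] by simp
    qed (use rel(1) that in auto)
    have "homology_group (int n - 1) ?X \<cong> homology_group (int n - 1) ?Y"
      by (rule group.iso_sym [OF _ is_isoI [OF iso]]) simp
    then have "homology_group (int n - 1) ?X \<cong> integer_group"
      using based(2) that iso_trans by (metis zero_neq_one)
    then show ?thesis
      using trivial_group_iso_iff [OF iso] based(1) that by auto
  qed
  moreover have "homology_group (int n) ?X \<cong> integer_group \<and>
      (\<forall>k. k \<notin> {0, int n} \<longrightarrow> trivial_group (homology_group k ?X))" if "odd n"
  proof -
    have iso: "hom_induced k ?X {} ?X ?B id \<in> iso (homology_group k ?X) (relative_homology_group k ?X ?B)" if "k \<noteq> 0" for k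
    proof (rule iso_hom_induced_acyclic_subspace [OF _ _ that])
      show "trivial_group (relative_homology_group 1 ?X ?B)"
        using rel(2) [OF \<open>odd n\<close>] assms by simp
    qed (use based(3) \<open>odd n\<close> in auto)
    have "homology_group (int n) ?X \<cong> integer_group"
      using iso_trans [OF is_isoI [OF iso [of "int n"]] rel(3)] n that by simp
    then show ?thesis
      using trivial_group_iso_iff [OF iso] rel(2) that by auto
  qed
  ultimately show ?thesis using zero by blast
qed

end
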